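(* Let $H$ be a complex Hilbert space and let $f:[0,\infty)\to\mathbb{R}$ be a continuous convex function that is normalized, i.e. $f(1)=0$. If $Q,P\in S_1(H)$, with $P$ invertible, and there exist $R\ge 1\ge r\ge 0$ such that $$r\operatorname{tr}(|T|^2)\le \operatorname{tr}\left(\left|Q^{1/2}TP^{-1/2}\right|^2\right)\le R\operatorname{tr}(|T|^2)\quad\text{for any } T\in\mathcal{B}_2(H),$$ then $$0\le S_f(Q,P)\le \tfrac12\left[f'_-(R)-f'_+(r)\right]V(Q,P)\le \tfrac12\left[f'_-(R)-f'_+(r)\right]\chi(Q,P)\le \tfrac14(R-r)\left[f'_-(R)-f'_+(r)\right],$$ where $V(Q,P)=\operatorname{tr}(|Q-P|)$ is the variational distance and $\chi(Q,P)=\left[\operatorname{tr}(Q^2P^{-1})-1\right]^{1/2}$.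
   Context: $H$ is a complex Hilbert space; $\mathcal{B}_1(H)$ and $\mathcal{B}_2(H)$ denote the trace class and Hilbert–Schmidt operators on $H$; $\mathcal{B}_2(H)$ is a Hilbert space with inner product $\langle U,W\rangle_2=\operatorname{tr}(W^*U)$; $|T|=(T^*T)^{1/2}$. $S_1(H):=\{P\in\mathcal{B}_1(H): P\ge 0,\ \operatorname{tr}(P)=1\}$. For $Q,P\in S_1(H)$ with $P$ invertible, the Araki transform is the positive selfadjoint operator $\mathfrak{A}_{Q,P}$ on $\mathcal{B}_2(H)$ given by $\mathfrak{A}_{Q,P}T:=QTP^{-1}$. For a continuous function $g:[0,\infty)\to\mathbb{R}$, with $g(\mathfrak{A}_{Q,P})$ defined by the continuous functional calculus, the quantum $g$-divergence is $S_g(Q,P):=\langle g(\mathfrak{A}_{Q,P})P^{1/2},P^{1/2}\rangle_2$. The variational distance is introduced by stating that for $g(t)=|t-1|$ one has $S_g(Q,P)=\operatorname{tr}(|Q-P|)=:V(Q,P)$. The $\chi^2$-distance is introduced by stating that for $g(t)=t^2-1$ one has $S_g(Q,P)=\operatorname{tr}(Q^2P^{-1})-1=:\chi^2(Q,P)$, and $\chi(Q,P):=\left(\chi^2(Q,P)\right)^{1/2}$. $f'_-$ and $f'_+$ are the left and right derivatives of $f$.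
   Formalization: The bound S_f ≤ ½[f'_-(R)−f'_+(r)]V fails for V = tr|Q−P| when Q and P do not commute, so V is taken as S_g(Q,P) with g(t)=|t−1| throughout the chain; for tr|Q−P| only the comparison with χ(Q,P) is asserted. *)

theory Defs
  imports "HOL-Analysis.Analysis" "HOL-Computational_Algebra.Polynomial"
begin

(* Complex Hilbert spaces, with the inner product linear in its first argument.  Norm, topology
   and completeness are those of the underlying real Hilbert space. *)
class complex_hilbert_space = real_inner + complete_space +
  fixes scaleC :: "complex \<Rightarrow> 'a \<Rightarrow> 'a"  (infixr "*\<^sub>C" 75)
    and cinner :: "'a \<Rightarrow> 'a \<Rightarrow> complex"
  assumes scaleC_add_right: "c *\<^sub>C (x + y) = c *\<^sub>C x + c *\<^sub>C y"
    and scaleC_add_left: "(c + d) *\<^sub>C x = c *\<^sub>C x + d *\<^sub>C x"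
    and scaleC_scaleC: "c *\<^sub>C (d *\<^sub>C x) = (c * d) *\<^sub>C x"
    and scaleR_scaleC: "s *\<^sub>R x = complex_of_real s *\<^sub>C x"
    and cinner_add_left: "cinner (x + y) z = cinner x z + cinner y z"
    and cinner_scaleC_left: "cinner (c *\<^sub>C x) y = c * cinner x y"
    and cinner_commute: "cinner x y = cnj (cinner y x)"
    and inner_eq_Re_cinner: "inner x y = Re (cinner x y)"

definition bounded_clinear :: "('a::complex_hilbert_space \<Rightarrow> 'a) \<Rightarrow> bool" where
  "bounded_clinear T \<longleftrightarrow> bounded_linear T \<and> (\<forall>c x. T (c *\<^sub>C x) = c *\<^sub>C T x)"

definition invertible_op :: "('a::complex_hilbert_space \<Rightarrow> 'a) \<Rightarrow> bool" where
  "invertible_op T \<longleftrightarrow> bounded_clinear T \<and>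
     (\<exists>S. bounded_clinear S \<and> S \<circ> T = id \<and> T \<circ> S = id)"

definition adj :: "('a::complex_hilbert_space \<Rightarrow> 'a) \<Rightarrow> ('a \<Rightarrow> 'a)" where
  "adj T = (THE S. bounded_clinear S \<and> (\<forall>x y. cinner (T x) y = cinner x (S y)))"

definition positive_op :: "('a::complex_hilbert_space \<Rightarrow> 'a) \<Rightarrow> bool" where
  "positive_op T \<longleftrightarrow> bounded_clinear T \<and>
     (\<forall>x. cinner (T x) x \<in> \<real> \<and> 0 \<le> Re (cinner (T x) x))"

definition sqrt_op :: "('a::complex_hilbert_space \<Rightarrow> 'a) \<Rightarrow> ('a \<Rightarrow> 'a)" where
  "sqrt_op T = (THE S. positive_op S \<and> S \<circ> S = T)"

definition abs_op :: "('a::complex_hilbert_space \<Rightarrow> 'a) \<Rightarrow> ('a \<Rightarrow> 'a)" where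
  "abs_op T = sqrt_op (adj T \<circ> T)"

definition orthonormal_basis :: "'a::complex_hilbert_space set \<Rightarrow> bool" where
  "orthonormal_basis E \<longleftrightarrow>
     (\<forall>x\<in>E. \<forall>y\<in>E. cinner x y = (if x = y then 1 else 0)) \<and>
     (\<forall>x. (\<forall>e\<in>E. cinner x e = 0) \<longrightarrow> x = 0)"

definition hilbert_schmidt :: "('a::complex_hilbert_space \<Rightarrow> 'a) \<Rightarrow> bool" where
  "hilbert_schmidt T \<longleftrightarrow> bounded_clinear T \<and>
     (\<exists>E. orthonormal_basis E \<and> (\<lambda>e. (norm (T e))\<^sup>2) summable_on E)"

definition trace_class :: "('a::complex_hilbert_space \<Rightarrow> 'a) \<Rightarrow> bool" where
  "trace_class T \<longleftrightarrow> bounded_clinear T \<and>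
     (\<exists>E. orthonormal_basis E \<and> (\<lambda>e. Re (cinner (abs_op T e) e)) summable_on E)"

(* For trace class operators the sum does not depend on the basis. *)
definition op_trace :: "('a::complex_hilbert_space \<Rightarrow> 'a) \<Rightarrow> complex" where
  "op_trace T = (\<Sum>\<^sub>\<infinity>e\<in>(SOME E. orthonormal_basis E). cinner (T e) e)"

(* The set S_1(H). *)
definition density_op :: "('a::complex_hilbert_space \<Rightarrow> 'a) \<Rightarrow> bool" where
  "density_op P \<longleftrightarrow> trace_class P \<and> positive_op P \<and> op_trace P = 1"

definition hs_inner :: "('a::complex_hilbert_space \<Rightarrow> 'a) \<Rightarrow> ('a \<Rightarrow> 'a) \<Rightarrow> complex" where
  "hs_inner U W = op_trace (adj W \<circ> U)"

definition hs_norm :: "('a::complex_hilbert_space \<Rightarrow> 'a) \<Rightarrow> real" where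
  "hs_norm T = sqrt (Re (hs_inner T T))"

(* Bounded operators on the Hilbert space B_2(H) of Hilbert-Schmidt operators.  Only the values
   on Hilbert-Schmidt arguments matter. *)
definition hs_bounded :: "(('a::complex_hilbert_space \<Rightarrow> 'a) \<Rightarrow> ('a \<Rightarrow> 'a)) \<Rightarrow> bool" where
  "hs_bounded \<Phi> \<longleftrightarrow>
     (\<forall>T. hilbert_schmidt T \<longrightarrow> hilbert_schmidt (\<Phi> T)) \<and>
     (\<forall>S T. hilbert_schmidt S \<longrightarrow> hilbert_schmidt T \<longrightarrow>
        \<Phi> (\<lambda>x. S x + T x) = (\<lambda>x. \<Phi> S x + \<Phi> T x)) \<and>
     (\<forall>c T. hilbert_schmidt T \<longrightarrow> \<Phi> (\<lambda>x. c *\<^sub>C T x) = (\<lambda>x. c *\<^sub>C \<Phi> T x)) \<and>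
     (\<exists>K. \<forall>T. hilbert_schmidt T \<longrightarrow> hs_norm (\<Phi> T) \<le> K * hs_norm T)"

definition hs_spectrum :: "(('a::complex_hilbert_space \<Rightarrow> 'a) \<Rightarrow> ('a \<Rightarrow> 'a)) \<Rightarrow> complex set" where
  "hs_spectrum \<Phi> = {z. \<not> (\<exists>\<Psi>. hs_bounded \<Psi> \<and>
     (\<forall>T. hilbert_schmidt T \<longrightarrow>
        \<Psi> (\<lambda>x. \<Phi> T x - z *\<^sub>C T x) = T \<and>
        (\<lambda>x. \<Phi> (\<Psi> T) x - z *\<^sub>C \<Psi> T x) = T))}"

definition hs_poly ::
    "real poly \<Rightarrow> (('a::complex_hilbert_space \<Rightarrow> 'a) \<Rightarrow> ('a \<Rightarrow> 'a)) \<Rightarrow> ('a \<Rightarrow> 'a) \<Rightarrow> ('a \<Rightarrow> 'a)" where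
  "hs_poly p \<Phi> T = (\<lambda>x. \<Sum>i\<le>degree p. coeff p i *\<^sub>R ((\<Phi> ^^ i) T) x)"

(* Continuous functional calculus of a bounded selfadjoint operator on B_2(H): the limit in
   operator norm of p_n(\<Phi>) for every sequence of polynomials p_n converging to g uniformly on the
   spectrum, which is real.  Extensionality makes the operator unique as a HOL function. *)
definition hs_fun_calc ::
    "(real \<Rightarrow> real) \<Rightarrow> (('a::complex_hilbert_space \<Rightarrow> 'a) \<Rightarrow> ('a \<Rightarrow> 'a)) \<Rightarrow> ('a \<Rightarrow> 'a) \<Rightarrow> ('a \<Rightarrow> 'a)" where
  "hs_fun_calc g \<Phi> = (THE \<Psi>. hs_bounded \<Psi> \<and> \<Psi> \<in> extensional {T. hilbert_schmidt T} \<and>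
     (\<forall>p. uniform_limit {t. complex_of_real t \<in> hs_spectrum \<Phi>} (\<lambda>n. poly (p n)) g sequentially \<longrightarrow>
        (\<forall>\<epsilon>>0. \<forall>\<^sub>F n in sequentially. \<forall>T. hilbert_schmidt T \<longrightarrow>
           hs_norm (\<lambda>x. hs_poly (p n) \<Phi> T x - \<Psi> T x) \<le> \<epsilon> * hs_norm T)))"

definition araki :: "('a::complex_hilbert_space \<Rightarrow> 'a) \<Rightarrow> ('a \<Rightarrow> 'a) \<Rightarrow> ('a \<Rightarrow> 'a) \<Rightarrow> ('a \<Rightarrow> 'a)" where
  "araki Q P T = Q \<circ> T \<circ> inv P"

(* The inner product is real for real g, so taking the real part only changes the type. *)
definition divergence ::
    "(real \<Rightarrow> real) \<Rightarrow> ('a::complex_hilbert_space \<Rightarrow> 'a) \<Rightarrow> ('a \<Rightarrow> 'a) \<Rightarrow> real" where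
  "divergence g Q P = Re (hs_inner (hs_fun_calc g (araki Q P) (sqrt_op P)) (sqrt_op P))"

(* The member g(t) = |t - 1| of the family of g-divergences.  It equals tr |Q - P| when Q and P
   commute, but not in general.  Take the direct sum decomposition C^2 + C and unit vectors m, n in
   R^3 at angle 60 degrees: 7 P = (2 + n.sigma) + 3 and 7 Q = (3 + m.sigma) + 1 give 9/14 here but
   tr |Q - P| = 8/14. *)
definition variational_distance ::
    "('a::complex_hilbert_space \<Rightarrow> 'a) \<Rightarrow> ('a \<Rightarrow> 'a) \<Rightarrow> real" where
  "variational_distance Q P = divergence (\<lambda>t. \<bar>t - 1\<bar>) Q P"

definition trace_norm_distance ::
    "('a::complex_hilbert_space \<Rightarrow> 'a) \<Rightarrow> ('a \<Rightarrow> 'a) \<Rightarrow> real" where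
  "trace_norm_distance Q P = Re (op_trace (abs_op (\<lambda>x. Q x - P x)))"

definition chi_distance ::
    "('a::complex_hilbert_space \<Rightarrow> 'a) \<Rightarrow> ('a \<Rightarrow> 'a) \<Rightarrow> real" where
  "chi_distance Q P = sqrt (Re (op_trace (Q \<circ> Q \<circ> inv P)) - 1)"

(* One-sided derivatives are taken in the extended reals: a continuous convex f on [0, \<infinity>) may have
   right derivative -\<infinity> at 0, as for f t = 1 - sqrt t. *)
definition left_deriv :: "(real \<Rightarrow> real) \<Rightarrow> real \<Rightarrow> ereal" where
  "left_deriv f x = Lim (at_left x) (\<lambda>y. ereal ((f y - f x) / (y - x)))"

definition right_deriv :: "(real \<Rightarrow> real) \<Rightarrow> real \<Rightarrow> ereal" where
  "right_deriv f x = Lim (at_right x) (\<lambda>y. ereal ((f y - f x) / (y - x)))"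

end

theory Submission
  imports Defs
begin

text \<open>An invertible trace class operator forces \<open>H\<close> to be finite dimensional. With eigenbases
  \<open>Q u = q u\<close>, \<open>P v = p v\<close>, the Araki transform multiplies the matrix entry \<open>\<langle>T v, u\<rangle>\<close> by the ratio
  \<open>q / p\<close>, so its functional calculus is a Schur multiplier and \<open>S_g(Q, P)\<close> is the mean of \<open>g\<close> at the
  ratios under the probability weights \<open>p \<bar>\<langle>v, u\<rangle>\<bar>^2\<close>. Under these weights the ratios have mean 1, and
  testing the hypothesis on rank one operators shows that they lie in \<open>[r, R]\<close>. What remains is a
  statement about a discrete random variable, plus a Cauchy-Schwarz estimate for the trace norm.\<close>

section \<open>Finite orthonormal bases\<close>

text \<open>The form of the conclusion is dictated by noncommuting \<open>Q\<close> and
  \<open>P\<close>, where \<open>tr |Q - P|\<close> and the divergence of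
  \<open>\<bar>t - 1\<bar>\<close> are different numbers. For \<open>f t = \<bar>t - 1\<bar>\<close>
  and \<open>r < 1 < R\<close> the factor \<open>(1/2) * D\<close> equals 1, so a bound of the
  divergence by the trace norm distance fails whenever the former number is the larger one. Hence
  the full chain is stated for the divergence, and the trace norm distance enters only through its
  comparison with chi. That comparison needs a duality argument of its own, since
  \<open>tr |Q - P|\<close> is not in general the mean of a function of the ratios. The other
  obstacle is that adjoints, square roots and the functional calculus are definite descriptions:
  they can be used only after existence and uniqueness are shown. A finite eigenbasis turns each of
  them into an explicit formula, so finiteness itself has to be obtained without spectral
  theory.\<close>

lemma cinner_add_right: "cinner x (y + z) = cinner x y + cinner (x::'a::complex_hilbert_space) z"
  by (metis cinner_add_left cinner_commute complex_cnj_add)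

lemma cinner_scaleC_right: "cinner (x::'a::complex_hilbert_space) (c *\<^sub>C y) = cnj c * cinner x y"
  by (metis cinner_scaleC_left cinner_commute complex_cnj_mult)

lemma cinner_zero_left [simp]: "cinner 0 (x::'a::complex_hilbert_space) = 0"
  by (metis add_cancel_right_right cinner_add_left)

lemma cinner_zero_right [simp]: "cinner (x::'a::complex_hilbert_space) 0 = 0"
  by (metis cinner_commute cinner_zero_left complex_cnj_zero)

lemma cinner_minus_left: "cinner (- x) (y::'a::complex_hilbert_space) = - cinner x y"
  by (metis add.right_inverse cinner_add_left cinner_zero_left minus_unique)

lemma cinner_diff_left: "cinner (x - y) (z::'a::complex_hilbert_space) = cinner x z - cinner y z"
  by (metis add_diff_cancel cinner_add_left diff_add_cancel)

lemma cinner_diff_right: "cinner (x::'a::complex_hilbert_space) (y - z) = cinner x y - cinner x z"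
  by (metis add_diff_cancel cinner_add_right diff_add_cancel)

lemma cinner_scaleR_left: "cinner (a *\<^sub>R x) (y::'a::complex_hilbert_space) = of_real a * cinner x y"
  by (simp add: scaleR_scaleC cinner_scaleC_left)

lemma cinner_scaleR_right: "cinner (x::'a::complex_hilbert_space) (a *\<^sub>R y) = of_real a * cinner x y"
  by (simp add: scaleR_scaleC cinner_scaleC_right)

lemma cinner_sum_left: "cinner (\<Sum>i\<in>I. f i) (y::'a::complex_hilbert_space) = (\<Sum>i\<in>I. cinner (f i) y)"
  by (induction I rule: infinite_finite_induct) (auto simp: cinner_add_left)

lemma cinner_sum_right: "cinner (y::'a::complex_hilbert_space) (\<Sum>i\<in>I. f i) = (\<Sum>i\<in>I. cinner y (f i))"
  by (induction I rule: infinite_finite_induct) (auto simp: cinner_add_right)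

lemmas cinner_simps = cinner_add_left cinner_add_right cinner_diff_left cinner_diff_right
  cinner_scaleC_left cinner_scaleC_right cinner_scaleR_left cinner_scaleR_right
  cinner_minus_left cinner_sum_left cinner_sum_right

lemma cinner_self: "cinner x (x::'a::complex_hilbert_space) = of_real ((norm x)\<^sup>2)"
proof (rule complex_eqI)
  have "Im (cinner x x) = - Im (cinner x x)"
    by (subst cinner_commute) simp
  then show "Im (cinner x x) = Im (of_real ((norm x)\<^sup>2))" by simp
  show "Re (cinner x x) = Re (of_real ((norm x)\<^sup>2))"
    by (simp add: inner_eq_Re_cinner[symmetric] dot_square_norm)
qed

lemma cinner_self_eq_zero: "cinner x (x::'a::complex_hilbert_space) = 0 \<longleftrightarrow> x = 0"
  by (simp add: cinner_self)

lemma cmod_cinner_commute: "cmod (cinner x (y::'a::complex_hilbert_space)) = cmod (cinner y x)"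
  by (metis cinner_commute complex_mod_cnj)

lemma cinner_mult_commute:
  "cinner x (y::'a::complex_hilbert_space) * cinner y x = of_real ((cmod (cinner x y))\<^sup>2)"
  by (metis cinner_commute complex_norm_square)

lemma norm_scaleC: "norm (c *\<^sub>C (x::'a::complex_hilbert_space)) = cmod c * norm x"
proof -
  have "of_real ((norm (c *\<^sub>C x))\<^sup>2) = (of_real ((cmod c * norm x)\<^sup>2) :: complex)"
    unfolding cinner_self[symmetric] power_mult_distrib of_real_mult complex_norm_square
    by (simp add: cinner_simps)
  then have "(norm (c *\<^sub>C x))\<^sup>2 = (cmod c * norm x)\<^sup>2" using of_real_eq_iff by blast
  then show ?thesis by (simp add: power2_eq_iff_nonneg)
qed

text \<open>A unimodular factor on \<open>x\<close> makes the inner product real and nonnegative,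
  which leaves the real Cauchy-Schwarz inequality.\<close>

lemma cmod_cinner_le: "cmod (cinner x (y::'a::complex_hilbert_space)) \<le> norm x * norm y"
proof (cases "cinner x y = 0")
  case False
  define c where "c = cnj (sgn (cinner x y))"
  have c: "cmod c = 1" using False by (simp add: c_def norm_sgn)
  have "cinner (c *\<^sub>C x) y = of_real (cmod (cinner x y))"
  proof -
    have "cinner (c *\<^sub>C x) y = (cinner x y * cnj (cinner x y)) / of_real (cmod (cinner x y))"
      by (simp add: cinner_simps c_def sgn_eq)
    also have "\<dots> = of_real (cmod (cinner x y))"
      using False by (simp add: complex_norm_square[symmetric] power2_eq_square)
    finally show ?thesis .
  qed
  then have "cmod (cinner x y) = inner (c *\<^sub>C x) y"
    by (simp add: inner_eq_Re_cinner)
  also have "\<dots> \<le> norm (c *\<^sub>C x) * norm y" by (rule norm_cauchy_schwarz)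
  finally show ?thesis by (simp add: norm_scaleC c)
qed simp

lemma scaleC_zero_left [simp]: "0 *\<^sub>C (x::'a::complex_hilbert_space) = 0"
  by (metis norm_eq_zero norm_scaleC mult_zero_left norm_zero)

lemma scaleC_zero_right [simp]: "c *\<^sub>C (0::'a::complex_hilbert_space) = 0"
  by (metis norm_eq_zero norm_scaleC mult_zero_right norm_zero)

lemma scaleC_one [simp]: "1 *\<^sub>C (x::'a::complex_hilbert_space) = x"
  by (metis of_real_1 scaleR_one scaleR_scaleC)

lemma bounded_linear_scaleC_left: "bounded_linear (\<lambda>c. c *\<^sub>C (x::'a::complex_hilbert_space))"
  by (rule bounded_linear_intro[where K = "norm x"])
    (simp_all add: scaleC_add_left norm_scaleC scaleR_scaleC scaleC_scaleC scaleR_conv_of_real)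

lemma bounded_linear_scaleC_right: "bounded_linear (\<lambda>x::'a::complex_hilbert_space. c *\<^sub>C x)"
  by (rule bounded_linear_intro[where K = "cmod c"])
    (simp_all add: scaleC_add_right norm_scaleC scaleR_scaleC scaleC_scaleC mult.commute)

lemma bounded_linear_cinner_left: "bounded_linear (\<lambda>x::'a::complex_hilbert_space. cinner x y)"
  by (rule bounded_linear_intro[where K = "norm y"])
    (simp_all add: cinner_simps cmod_cinner_le scaleR_conv_of_real)

section \<open>Bounded complex linear operators\<close>

lemma bounded_clinear_add: "bounded_clinear T \<Longrightarrow> T (x + y) = T x + T y"
  and bounded_clinear_scaleC: "bounded_clinear T \<Longrightarrow> T (c *\<^sub>C x) = c *\<^sub>C T x"
  and bounded_clinear_zero: "bounded_clinear T \<Longrightarrow> T 0 = 0"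
  and bounded_clinear_diff: "bounded_clinear T \<Longrightarrow> T (x - y) = T x - T y"
  and bounded_clinear_sum: "bounded_clinear T \<Longrightarrow> T (\<Sum>i\<in>I. f i) = (\<Sum>i\<in>I. T (f i))"
  and bounded_clinear_scaleR: "bounded_clinear T \<Longrightarrow> T (a *\<^sub>R x) = a *\<^sub>R T x"
  by (auto simp: bounded_clinear_def linear_simps linear_sum bounded_linear.linear)

lemma bounded_clinear_rank_one: "bounded_clinear (\<lambda>x::'a::complex_hilbert_space. (c * cinner x y) *\<^sub>C z)"
  unfolding bounded_clinear_def
  by (auto simp: cinner_simps scaleC_scaleC mult_ac
      intro: bounded_linear_compose[OF bounded_linear_scaleC_left bounded_linear_const_mult[OF bounded_linear_cinner_left]])

lemma bounded_clinear_setsum: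
  "(\<And>i. i \<in> I \<Longrightarrow> bounded_clinear (F i)) \<Longrightarrow>
   bounded_clinear (\<lambda>x::'a::complex_hilbert_space. \<Sum>i\<in>I. F i x)"
  unfolding bounded_clinear_def
  by (auto intro!: bounded_linear_sum simp: bounded_linear.linear[OF bounded_linear_scaleC_right, THEN linear_sum])

lemma bounded_clinear_compose:
  "bounded_clinear S \<Longrightarrow> bounded_clinear T \<Longrightarrow> bounded_clinear (S \<circ> (T::'a::complex_hilbert_space \<Rightarrow> 'a))"
  unfolding bounded_clinear_def by (auto simp: comp_def intro: bounded_linear_compose)

lemma bounded_clinear_plus:
  "bounded_clinear S \<Longrightarrow> bounded_clinear T \<Longrightarrow> bounded_clinear (\<lambda>x::'a::complex_hilbert_space. S x + T x)"
  unfolding bounded_clinear_def by (auto simp: scaleC_add_right intro: bounded_linear_add)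

lemma scaleC_diff_right: "c *\<^sub>C (x - y) = c *\<^sub>C x - c *\<^sub>C (y::'a::complex_hilbert_space)"
  by (metis add_diff_cancel diff_add_cancel scaleC_add_right)

lemma bounded_clinear_minus:
  "bounded_clinear S \<Longrightarrow> bounded_clinear T \<Longrightarrow> bounded_clinear (\<lambda>x::'a::complex_hilbert_space. S x - T x)"
  unfolding bounded_clinear_def by (auto simp: scaleC_diff_right intro: bounded_linear_sub)

lemma bounded_clinear_scaled:
  "bounded_clinear T \<Longrightarrow> bounded_clinear (\<lambda>x::'a::complex_hilbert_space. c *\<^sub>C T x)"
  unfolding bounded_clinear_def
  by (auto simp: scaleC_scaleC mult.commute intro: bounded_linear_compose[OF bounded_linear_scaleC_right])

section \<open>Coordinates, Parseval, Bessel and the size of orthonormal sets\<close>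

definition orthonormal :: "'a::complex_hilbert_space set \<Rightarrow> bool" where
  "orthonormal S \<longleftrightarrow> (\<forall>x\<in>S. \<forall>y\<in>S. cinner x y = (if x = y then 1 else 0))"

definition finite_basis :: "'a::complex_hilbert_space set \<Rightarrow> bool" where
  "finite_basis E \<longleftrightarrow> finite E \<and> orthonormal_basis E"

lemma finite_basis_finite: "finite_basis E \<Longrightarrow> finite E"
  and finite_basis_cinner: "finite_basis E \<Longrightarrow> x \<in> E \<Longrightarrow> y \<in> E \<Longrightarrow> cinner x y = (if x = y then 1 else 0)"
  by (auto simp: finite_basis_def orthonormal_basis_def)

lemma orthonormal_norm:
  assumes "orthonormal S" "x \<in> S" shows "norm x = 1"
proof -
  have "of_real ((norm x)\<^sup>2) = (of_real 1 :: complex)"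
    using assms unfolding cinner_self[symmetric] by (simp add: orthonormal_def)
  then have "(norm x)\<^sup>2 = 1" using of_real_eq_iff by blast
  then show ?thesis using norm_ge_zero[of x] by (auto simp: power2_eq_1_iff simp del: norm_ge_zero)
qed

lemma finite_basis_norm: "finite_basis E \<Longrightarrow> x \<in> E \<Longrightarrow> norm x = 1"
  using orthonormal_norm[of E x] by (auto simp: finite_basis_def orthonormal_basis_def orthonormal_def)

text \<open>The remainder is orthogonal to \<open>E\<close>, and a basis is by definition an
  orthonormal set with trivial orthogonal complement.\<close>

lemma finite_basis_expand:
  assumes "finite_basis E"
  shows "(\<Sum>e\<in>E. cinner x e *\<^sub>C e) = x"
proof -
  have "cinner (x - (\<Sum>e\<in>E. cinner x e *\<^sub>C e)) b = 0" if "b \<in> E" for b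
  proof -
    have "(\<Sum>e\<in>E. cinner x e * cinner e b) = (\<Sum>e\<in>E. if e = b then cinner x e else 0)"
      by (rule sum.cong) (auto simp: finite_basis_cinner[OF assms _ that])
    also have "\<dots> = cinner x b" using that finite_basis_finite[OF assms] by simp
    finally show ?thesis by (simp add: cinner_simps)
  qed
  then show ?thesis using assms unfolding finite_basis_def orthonormal_basis_def by fastforce
qed

lemma finite_basis_parseval:
  assumes "finite_basis E"
  shows "(\<Sum>e\<in>E. cinner x e * cinner e y) = cinner x y"
proof -
  have "cinner x y = cinner (\<Sum>e\<in>E. cinner x e *\<^sub>C e) y" by (simp add: finite_basis_expand[OF assms])
  then show ?thesis by (simp add: cinner_simps)
qed

lemma finite_basis_norm_sq:
  assumes "finite_basis E"
  shows "(\<Sum>e\<in>E. (cmod (cinner x e))\<^sup>2) = (norm x)\<^sup>2"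
proof -
  have "of_real (\<Sum>e\<in>E. (cmod (cinner x e))\<^sup>2) = (of_real ((norm x)\<^sup>2) :: complex)"
    using finite_basis_parseval[OF assms, of x x] by (simp only: of_real_sum cinner_self cinner_mult_commute)
  then show ?thesis using of_real_eq_iff by blast
qed

lemma bounded_clinear_eqI:
  assumes "finite_basis E" "bounded_clinear S" "bounded_clinear T" "\<And>e. e \<in> E \<Longrightarrow> S e = T e"
  shows "S = T"
proof
  fix x
  have "S (\<Sum>e\<in>E. cinner x e *\<^sub>C e) = T (\<Sum>e\<in>E. cinner x e *\<^sub>C e)"
    using assms by (simp add: bounded_clinear_sum bounded_clinear_scaleC)
  then show "S x = T x" by (simp add: finite_basis_expand[OF assms(1)])
qed

lemma finite_basis_vec_eqI:
  assumes "finite_basis E" "\<And>e. e \<in> E \<Longrightarrow> cinner x e = cinner y e"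
  shows "x = y"
  using assms by (metis (mono_tags, lifting) finite_basis_expand sum.cong)

lemma orthonormal_bessel:
  assumes "finite S" "orthonormal S"
  shows "(\<Sum>s\<in>S. (cmod (cinner x s))\<^sup>2) \<le> (norm x)\<^sup>2"
proof -
  define y where "y = (\<Sum>s\<in>S. cinner x s *\<^sub>C s)"
  have xy: "cinner x y = of_real (\<Sum>s\<in>S. (cmod (cinner x s))\<^sup>2)"
    by (simp add: y_def cinner_simps complex_norm_square mult.commute del: of_real_power)
  have ys: "cinner y s = cinner x s" if "s \<in> S" for s
  proof -
    have "(\<Sum>e\<in>S. cinner x e * cinner e s) = (\<Sum>e\<in>S. if e = s then cinner x e else 0)"
      by (rule sum.cong) (use assms that in \<open>auto simp: orthonormal_def\<close>)
    then show ?thesis using that assms by (simp add: y_def cinner_simps)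
  qed
  have yy: "cinner y y = of_real (\<Sum>s\<in>S. (cmod (cinner x s))\<^sup>2)"
  proof -
    have "cinner y y = (\<Sum>s\<in>S. cnj (cinner x s) * cinner y s)"
      by (subst (2) y_def) (simp add: cinner_simps)
    also have "\<dots> = of_real (\<Sum>s\<in>S. (cmod (cinner x s))\<^sup>2)"
      by (simp add: ys complex_norm_square mult.commute del: of_real_power)
    finally show ?thesis .
  qed
  have "Re (cinner (x - y) (x - y)) \<ge> 0" by (simp add: cinner_self)
  moreover have "Re (cinner y x) = Re (cinner x y)" by (subst cinner_commute) simp
  ultimately show ?thesis using xy yy by (simp add: cinner_simps cinner_self[of x])
qed

text \<open>Count \<open>\<Sum> |<s, e>|^2\<close> over \<open>S\<close> and \<open>E\<close> in two
  ways: Parseval along \<open>E\<close> gives \<open>card S\<close>, Bessel along \<open>S\<close>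
  gives at most \<open>card E\<close>. This takes the place of a dimension theory.\<close>

lemma orthonormal_card_le:
  fixes E S :: "'a::complex_hilbert_space set"
  assumes "finite_basis E" "finite S" "orthonormal S"
  shows "card S \<le> card E"
proof -
  have "real (card S) = (\<Sum>s\<in>S. (norm s)\<^sup>2)" by (simp add: orthonormal_norm[OF assms(3)])
  also have "\<dots> = (\<Sum>s\<in>S. \<Sum>e\<in>E. (cmod (cinner s e))\<^sup>2)" by (simp add: finite_basis_norm_sq[OF assms(1)])
  also have "\<dots> = (\<Sum>e\<in>E. \<Sum>s\<in>S. (cmod (cinner e s))\<^sup>2)"
    by (subst sum.swap) (simp add: cmod_cinner_commute)
  also have "\<dots> \<le> (\<Sum>e\<in>E. (norm e)\<^sup>2)" by (intro sum_mono orthonormal_bessel assms)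
  also have "\<dots> = real (card E)" by (simp add: finite_basis_norm[OF assms(1)])
  finally show ?thesis by simp
qed

text \<open>\<open>op_trace\<close> sums over an unspecified orthonormal basis, which has to be
  known to be finite.\<close>

lemma finite_basis_any:
  fixes E F :: "'a::complex_hilbert_space set"
  assumes "finite_basis E" "orthonormal_basis F"
  shows "finite_basis F"
proof (rule ccontr)
  assume "\<not> ?thesis"
  then have "infinite F" using assms by (simp add: finite_basis_def)
  then obtain S where S: "finite S \<and> card S = Suc (card E) \<and> S \<subseteq> F"
    using infinite_arbitrarily_large[of F "Suc (card E)"] by blast
  then have "orthonormal S" using assms(2) by (simp add: orthonormal_basis_def orthonormal_def subset_iff)
  then show False using orthonormal_card_le[OF assms(1), of S] S by simp
qed

text \<open>The ball is a closed subset of the image of a compact set of coordinate vectors. This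
  supplies the maximum needed to find eigenvectors.\<close>

lemma compact_unit_ball:
  fixes E :: "'a::complex_hilbert_space set"
  assumes "finite_basis E"
  shows "compact (cball (0::'a) 1)"
proof -
  let ?f = "\<lambda>c. \<Sum>e\<in>E. c e *\<^sub>C e"
  \<comment> \<open>Coordinates are functions on the whole space, frozen at 0 outside
    \<open>E\<close>, so that Tychonoff applies to a product over the full type.\<close>
  let ?K = "PiE UNIV (\<lambda>e. if e \<in> E then cball (0::complex) 1 else {0})"
  have "compactin (product_topology (\<lambda>_. euclidean) UNIV) ?K"
    by (auto simp: compactin_PiE)
  then have "compact ?K"
    by (simp add: euclidean_product_topology)
  moreover have "continuous_on ?K ?f"
    by (intro continuous_on_sum bounded_linear.continuous_on[OF bounded_linear_scaleC_left]
        continuous_on_subset[OF continuous_on_product_coordinates]) auto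
  ultimately have "compact (?f ` ?K)" by (rule compact_continuous_image[rotated])
  moreover have "?f ` ?K \<inter> cball 0 1 = cball 0 1"
  proof (rule Int_absorb1)
    show "cball 0 1 \<subseteq> ?f ` ?K"
    proof
      fix x :: 'a assume x: "x \<in> cball 0 1"
      have "cmod (cinner x e) \<le> 1" if "e \<in> E" for e
        using cmod_cinner_le[of x e] finite_basis_norm[OF assms that] x by simp
      then have "(\<lambda>e. if e \<in> E then cinner x e else 0) \<in> ?K" by auto
      moreover have "?f (\<lambda>e. if e \<in> E then cinner x e else 0) = x"
        using finite_basis_expand[OF assms, of x] by simp
      ultimately show "x \<in> ?f ` ?K" by (intro image_eqI[OF sym])
    qed
  qed
  ultimately show ?thesis using compact_Int_closed[OF _ closed_cball, of "?f ` ?K" 0 1] by simp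
qed

section \<open>Spectral theorem, square roots and traces\<close>

lemma adj_eqI:
  fixes T :: "'a::complex_hilbert_space \<Rightarrow> 'a"
  assumes "bounded_clinear S" "\<And>x y. cinner (T x) y = cinner x (S y)"
  shows "adj T = S"
  unfolding adj_def
proof (rule the_equality)
  show "bounded_clinear S \<and> (\<forall>x y. cinner (T x) y = cinner x (S y))" using assms by blast
  fix S' assume S': "bounded_clinear S' \<and> (\<forall>x y. cinner (T x) y = cinner x (S' y))"
  show "S' = S"
  proof
    fix y
    have "cinner (S' y - S y) (S' y - S y) = 0"
      using S' assms by (metis cinner_diff_right right_minus_eq)
    then show "S' y = S y" by (simp add: cinner_self_eq_zero)
  qed
qed

text \<open>An explicit formula in the basis replaces the Riesz representation theorem.\<close>

lemma adj_bounded_clinear_cinner: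
  fixes T :: "'a::complex_hilbert_space \<Rightarrow> 'a" and E :: "'a set"
  assumes E: "finite_basis E" and T: "bounded_clinear T"
  shows "bounded_clinear (adj T)" "cinner (T x) y = cinner x (adj T y)"
proof -
  let ?S = "\<lambda>y. \<Sum>e\<in>E. (1 * cinner y (T e)) *\<^sub>C e"
  have S: "bounded_clinear ?S" by (intro bounded_clinear_setsum bounded_clinear_rank_one)
  have eq: "cinner (T x) y = cinner x (?S y)" for x y
  proof -
    have "cinner (T x) y = cinner (T (\<Sum>e\<in>E. cinner x e *\<^sub>C e)) y"
      by (simp add: finite_basis_expand[OF E])
    also have "\<dots> = (\<Sum>e\<in>E. cinner x e * cinner (T e) y)"
      by (simp add: bounded_clinear_sum[OF T] bounded_clinear_scaleC[OF T] cinner_simps)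
    also have "\<dots> = cinner x (?S y)"
      by (simp add: cinner_simps mult.commute cinner_commute[of "T _" y])
    finally show ?thesis .
  qed
  have "adj T = ?S" by (rule adj_eqI[OF S eq])
  then show "bounded_clinear (adj T)" "cinner (T x) y = cinner x (adj T y)"
    using S eq[of x y] by auto
qed

lemma positive_op_clinear: "positive_op A \<Longrightarrow> bounded_clinear A"
  by (simp add: positive_op_def)

text \<open>Polarization: the quadratic form is real at \<open>x + y\<close> and at
  \<open>x + \<i> *\<^sub>C y\<close>, which fixes the imaginary and the real parts.\<close>

lemma positive_op_selfadjoint:
  fixes A :: "'a::complex_hilbert_space \<Rightarrow> 'a"
  assumes "positive_op A"
  shows "cinner (A x) y = cinner x (A y)"
proof -
  note A = positive_op_clinear[OF assms]
  have re: "Im (cinner (A z) z) = 0" for z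
    using assms by (simp add: positive_op_def complex_is_Real_iff)
  have "Im (cinner (A x) y) + Im (cinner (A y) x) = 0"
    using re[of "x + y"] by (simp add: bounded_clinear_add[OF A] cinner_simps re)
  moreover have "Re (cinner (A y) x) - Re (cinner (A x) y) = 0"
    using re[of "x + \<i> *\<^sub>C y"]
    by (simp add: bounded_clinear_add[OF A] bounded_clinear_scaleC[OF A] cinner_simps re)
  ultimately have "cinner (A x) y = cnj (cinner (A y) x)"
    by (intro complex_eqI) simp_all
  then show ?thesis by (metis cinner_commute)
qed

text \<open>At a zero of a nonnegative form the first variation vanishes. Nonnegativity is asked for
  only along the line through \<open>x\<close> in direction \<open>y\<close>, because the
  application has it only on a subspace.\<close>

lemma semidefinite_null_vector:
  fixes A :: "'a::complex_hilbert_space \<Rightarrow> 'a"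
  assumes A: "bounded_clinear A" and sa: "\<And>x y. cinner (A x) y = cinner x (A y)"
    and nonneg: "\<And>c. 0 \<le> Re (cinner (A (x + c *\<^sub>C y)) (x + c *\<^sub>C y))"
    and null: "Re (cinner (A x) x) = 0"
  shows "cinner (A x) y = 0"
proof (rule ccontr)
  let ?z = "cinner (A x) y" and ?a = "Re (cinner (A y) y)"
  assume z: "?z \<noteq> 0"
  \<comment> \<open>Moving by \<open>- t * ?z\<close> along \<open>y\<close> changes the form by
    \<open>|?z|^2 * (t^2 * ?a - 2 * t)\<close>; this \<open>t\<close> is small enough for the linear
    term to win.\<close>
  define t where "t = 1 / (1 + \<bar>?a\<bar>)"
  have t: "t > 0" "t * ?a < 2"
    by (auto simp: t_def field_simps abs_if)
  have yx: "cinner (A y) x = cnj ?z" by (metis sa cinner_commute)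
  have "0 \<le> Re (cinner (A (x + (- t * ?z) *\<^sub>C y)) (x + (- t * ?z) *\<^sub>C y))" by (rule nonneg)
  also have "cinner (A (x + (- t * ?z) *\<^sub>C y)) (x + (- t * ?z) *\<^sub>C y)
      = cinner (A x) x - of_real (2 * t) * (?z * cnj ?z) + of_real (t\<^sup>2) * (?z * cnj ?z) * cinner (A y) y"
    by (simp add: bounded_clinear_add[OF A] bounded_clinear_scaleC[OF A] cinner_simps yx algebra_simps power2_eq_square)
  also have "Re \<dots> = (cmod ?z)\<^sup>2 * t * (t * ?a - 2)"
    by (simp add: complex_norm_square[symmetric] null algebra_simps power2_eq_square)
  finally have "0 \<le> (cmod ?z)\<^sup>2 * t * (t * ?a - 2)" .
  moreover have "(cmod ?z)\<^sup>2 * t * (t * ?a - 2) < 0"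
    using z t by (intro mult_pos_neg) auto
  ultimately show False by simp
qed

text \<open>Maximise the Rayleigh quotient on the orthogonal complement \<open>?W\<close> of
  \<open>S\<close>. Since \<open>S\<close> consists of eigenvectors, \<open>A\<close> maps
  \<open>?W\<close> to itself, and a maximiser is an eigenvector.\<close>

lemma selfadjoint_eigenvector:
  fixes A :: "'a::complex_hilbert_space \<Rightarrow> 'a" and E :: "'a set"
  assumes E: "finite_basis E" and A: "bounded_clinear A"
    and sa: "\<And>x y. cinner (A x) y = cinner x (A y)"
    and eig: "\<And>s. s \<in> S \<Longrightarrow> \<exists>\<mu>::real. A s = \<mu> *\<^sub>R s"
    and z: "z \<noteq> 0" "\<And>s. s \<in> S \<Longrightarrow> cinner z s = 0"
  obtains x \<mu> where "norm x = 1" "\<And>s. s \<in> S \<Longrightarrow> cinner x s = 0" "A x = (\<mu>::real) *\<^sub>R x"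
proof -
  let ?W = "{x. \<forall>s\<in>S. cinner x s = 0}"
  \<comment> \<open>Intersecting with the ball presents the unit sphere of \<open>?W\<close> as a
    closed part of a compact set.\<close>
  let ?K = "cball 0 1 \<inter> (sphere 0 1 \<inter> ?W)"
  have "?W = (\<Inter>s\<in>S. {x. cinner x s = 0})" by auto
  moreover have "closed (\<Inter>s\<in>S. {x. cinner x s = 0})"
    by (intro closed_INT ballI closed_Collect_eq bounded_linear.continuous_on[OF bounded_linear_cinner_left]
       continuous_on_const continuous_on_id)
  ultimately have "closed ?W" by simp
  moreover have "closed (sphere (0::'a) 1)"
    unfolding sphere_def by (intro closed_Collect_eq continuous_intros)
  ultimately have "compact ?K"
    by (intro compact_Int_closed compact_unit_ball[OF E] closed_Int)
  moreover have "(inverse (norm z)) *\<^sub>R z \<in> ?K" using z by (auto simp: cinner_simps)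
  then have "?K \<noteq> {}" by (rule ex_in_conv[THEN iffD1, OF exI])
  moreover have "continuous_on ?K (\<lambda>x. inner (A x) x)"
    using A unfolding bounded_clinear_def
    by (intro continuous_on_inner bounded_linear.continuous_on[of A] continuous_on_id) simp
  ultimately have "\<exists>x\<in>?K. \<forall>y\<in>?K. inner (A y) y \<le> inner (A x) x"
    by (rule continuous_attains_sup)
  then obtain x where x: "x \<in> ?K" and max: "\<And>y. y \<in> ?K \<Longrightarrow> inner (A y) y \<le> inner (A x) x"
    by (elim bexE) simp
  define m where "m = inner (A x) x"
  have W_le: "inner (A y) y \<le> m * (norm y)\<^sup>2" if "y \<in> ?W" for y
  proof (cases "y = 0")
    case False
    have "(inverse (norm y)) *\<^sub>R y \<in> ?K" using False that by (auto simp: cinner_simps)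
    then have "inner (A ((inverse (norm y)) *\<^sub>R y)) ((inverse (norm y)) *\<^sub>R y) \<le> m"
      unfolding m_def by (rule max)
    then show ?thesis using False
      by (simp add: bounded_clinear_scaleR[OF A] field_simps power2_eq_square)
  qed (simp add: bounded_clinear_zero[OF A])
  \<comment> \<open>\<open>B = m - A\<close> is nonnegative on \<open>?W\<close> and its form
    vanishes at \<open>x\<close>. As \<open>B x\<close> lies in \<open>?W\<close>, it may serve as
    the test vector, giving \<open>B x = 0\<close>.\<close>
  define B where "B = (\<lambda>x. of_real m *\<^sub>C x - A x)"
  have B: "bounded_clinear B"
  proof -
    have "bounded_clinear (\<lambda>x::'a. x)" by (simp add: bounded_clinear_def bounded_linear_ident)
    then show ?thesis unfolding B_def by (intro bounded_clinear_minus bounded_clinear_scaled A)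
  qed
  have saB: "cinner (B x) y = cinner x (B y)" for x y
    by (simp add: B_def cinner_simps sa)
  have ReB: "Re (cinner (B y) y) = m * (norm y)\<^sup>2 - inner (A y) y" for y
    by (simp add: B_def cinner_simps cinner_self inner_eq_Re_cinner)
  have xW: "x \<in> ?W" and nx: "norm x = 1" using x by auto
  have "A x \<in> ?W"
  proof clarify
    fix s assume s: "s \<in> S"
    then obtain \<mu> :: real where "A s = \<mu> *\<^sub>R s" using eig by blast
    then show "cinner (A x) s = 0" using xW s by (simp add: sa cinner_simps)
  qed
  then have BW: "B x \<in> ?W" using xW by (simp add: B_def cinner_simps)
  have "cinner (B x) (B x) = 0"
  proof (rule semidefinite_null_vector[OF B saB])
    show "Re (cinner (B x) x) = 0"
      using nx by (simp add: ReB m_def)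
    fix c
    let ?y = "x + c *\<^sub>C B x"
    have "?y \<in> ?W" using xW BW by (simp add: cinner_simps)
    from W_le[OF this] show "0 \<le> Re (cinner (B ?y) ?y)" by (simp add: ReB)
  qed
  then have "A x = m *\<^sub>R x"
    by (simp add: cinner_self_eq_zero) (simp add: B_def scaleR_scaleC)
  then show thesis using that nx xW by blast
qed

text \<open>An orthonormal set of eigenvectors of largest size is a basis: a nonzero vector
  orthogonal to it would yield a further eigenvector.\<close>

lemma selfadjoint_eigenbasis:
  fixes A :: "'a::complex_hilbert_space \<Rightarrow> 'a" and E :: "'a set"
  assumes E: "finite_basis E" and A: "bounded_clinear A"
    and sa: "\<And>x y. cinner (A x) y = cinner x (A y)"
  obtains F d where "finite_basis F" "\<And>e. e \<in> F \<Longrightarrow> A e = (d e::real) *\<^sub>R e"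
proof -
  define \<S> where "\<S> = (\<lambda>S. finite S \<and> orthonormal S \<and> (\<forall>s\<in>S. \<exists>\<mu>::real. A s = \<mu> *\<^sub>R s))"
  have "\<S> {}" by (simp add: \<S>_def orthonormal_def)
  moreover have "\<forall>S. \<S> S \<longrightarrow> card S < Suc (card E)"
    unfolding \<S>_def by (intro allI impI le_imp_less_Suc orthonormal_card_le[OF E]) auto
  ultimately obtain S where S: "\<S> S" and max: "\<And>T. \<S> T \<Longrightarrow> card T \<le> card S"
    using ex_has_greatest_nat[of \<S> "{}" card "Suc (card E)"] by blast
  have "orthonormal_basis S"
  proof (rule ccontr)
    assume "\<not> ?thesis"
    then obtain z where z: "z \<noteq> 0" "\<And>s. s \<in> S \<Longrightarrow> cinner z s = 0"
      using S by (auto simp: orthonormal_basis_def \<S>_def orthonormal_def)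
    have "\<And>s. s \<in> S \<Longrightarrow> \<exists>\<mu>::real. A s = \<mu> *\<^sub>R s" using S by (simp add: \<S>_def)
    from selfadjoint_eigenvector[OF E A sa this z] obtain x and \<mu> :: real where
      x: "norm x = 1" "\<And>s. s \<in> S \<Longrightarrow> cinner x s = 0" "A x = \<mu> *\<^sub>R x" by metis
    have "x \<notin> S" using x(1) x(2)[of x] by (auto simp: cinner_self)
    moreover have "\<S> (insert x S)"
    proof -
      have "cinner s x = 0" if "s \<in> S" for s
        using x(2)[OF that] cinner_commute[of s x] by simp
      then have "orthonormal (insert x S)"
        using S x \<open>x \<notin> S\<close> by (auto simp: \<S>_def orthonormal_def cinner_self)
      then show ?thesis using S x by (auto simp: \<S>_def)
    qed
    ultimately show False using max[of "insert x S"] S by (simp add: \<S>_def)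
  qed
  then have "finite_basis S" using S by (simp add: finite_basis_def \<S>_def)
  moreover obtain d where "\<And>e. e \<in> S \<Longrightarrow> A e = (d e::real) *\<^sub>R e"
    using S unfolding \<S>_def by metis
  ultimately show thesis by (rule that)
qed

section \<open>Operators diagonal in an orthonormal basis\<close>

definition diag_op :: "'a::complex_hilbert_space set \<Rightarrow> ('a \<Rightarrow> real) \<Rightarrow> 'a \<Rightarrow> 'a" where
  "diag_op E d x = (\<Sum>e\<in>E. (of_real (d e) * cinner x e) *\<^sub>C e)"

lemma diag_op_clinear: "bounded_clinear (diag_op E d)"
  unfolding diag_op_def[abs_def] by (intro bounded_clinear_setsum bounded_clinear_rank_one)

lemma cinner_diag_op:
  assumes "finite_basis E" "e \<in> E"
  shows "cinner (diag_op E d x) e = of_real (d e) * cinner x e"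
proof -
  have "(\<Sum>b\<in>E. of_real (d b) * cinner x b * cinner b e) = (\<Sum>b\<in>E. if b = e then of_real (d e) * cinner x e else 0)"
    by (rule sum.cong) (auto simp: finite_basis_cinner[OF assms(1) _ assms(2)])
  then show ?thesis using assms finite_basis_finite[OF assms(1)] by (simp add: diag_op_def cinner_simps)
qed

lemma diag_op_basis:
  assumes "finite_basis E" "e \<in> E"
  shows "diag_op E d e = of_real (d e) *\<^sub>C e"
  by (rule finite_basis_vec_eqI[OF assms(1)])
    (simp add: cinner_diag_op[OF assms(1)] cinner_simps finite_basis_cinner[OF assms(1) assms(2)])

lemma eq_diag_op:
  assumes "finite_basis E" "bounded_clinear A" "\<And>e. e \<in> E \<Longrightarrow> A e = (d e::real) *\<^sub>R e"
  shows "A = diag_op E d"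
  by (rule bounded_clinear_eqI[OF assms(1,2) diag_op_clinear])
    (simp add: assms diag_op_basis[OF assms(1)] scaleR_scaleC)

lemma diag_op_cong: "(\<And>e. e \<in> E \<Longrightarrow> c e = d e) \<Longrightarrow> diag_op E c = diag_op E d"
  by (auto simp: diag_op_def fun_eq_iff intro!: sum.cong)

lemma diag_op_compose:
  assumes "finite_basis E"
  shows "diag_op E c \<circ> diag_op E d = diag_op E (\<lambda>e. c e * d e)"
  by (rule bounded_clinear_eqI[OF assms bounded_clinear_compose[OF diag_op_clinear diag_op_clinear] diag_op_clinear])
    (simp add: diag_op_basis[OF assms] bounded_clinear_scaleC[OF diag_op_clinear] scaleC_scaleC mult.commute)

lemma diag_op_one: "finite_basis E \<Longrightarrow> diag_op E (\<lambda>_. 1) = id"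
  by (auto simp: diag_op_def fun_eq_iff finite_basis_expand)

lemma diag_op_selfadjoint: "cinner (diag_op E d x) y = cinner x (diag_op E d y)"
  by (simp add: diag_op_def cinner_simps mult_ac cinner_commute[of _ y])

lemma adj_diag_op: "adj (diag_op E d) = diag_op E d"
  by (rule adj_eqI[OF diag_op_clinear diag_op_selfadjoint])

lemma cinner_diag_op_self:
  "cinner (diag_op E d x) x = of_real (\<Sum>e\<in>E. d e * (cmod (cinner x e))\<^sup>2)"
  by (simp add: diag_op_def cinner_simps mult.assoc cinner_mult_commute)

lemma positive_diag_op: "(\<And>e. e \<in> E \<Longrightarrow> 0 \<le> d e) \<Longrightarrow> positive_op (diag_op E d)"
  by (auto simp: positive_op_def diag_op_clinear cinner_diag_op_self intro!: sum_nonneg)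

lemma positive_op_eigenbasis:
  fixes A :: "'a::complex_hilbert_space \<Rightarrow> 'a" and E :: "'a set"
  assumes E: "finite_basis E" and A: "positive_op A"
  obtains F d where "finite_basis F" "A = diag_op F d" "\<And>e. e \<in> F \<Longrightarrow> 0 \<le> d e"
proof -
  obtain F d where F: "finite_basis F" and d: "\<And>e. e \<in> F \<Longrightarrow> A e = (d e::real) *\<^sub>R e"
    using selfadjoint_eigenbasis[OF E positive_op_clinear[OF A] positive_op_selfadjoint[OF A]] by blast
  have "0 \<le> d e" if "e \<in> F" for e
    using A d[OF that] finite_basis_norm[OF F that]
    unfolding positive_op_def by (metis Re_complex_of_real cinner_scaleR_left cinner_self mult.right_neutral of_real_1 one_power2)
  then show thesis using that[OF F eq_diag_op[OF F positive_op_clinear[OF A] d]] by blast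
qed

text \<open>The point is uniqueness of the positive root \<open>S\<close>, checked on one
  eigenvector \<open>e\<close> at a time. For eigenvalue 0,
  \<open>|S e|^2 = <e, S (S e)> = 0\<close>.\<close>

lemma sqrt_op_diag_op:
  assumes E: "finite_basis E" and d: "\<And>e. e \<in> E \<Longrightarrow> 0 \<le> d e"
  shows "sqrt_op (diag_op E d) = diag_op E (\<lambda>e. sqrt (d e))"
  unfolding sqrt_op_def
proof (rule the_equality)
  show "positive_op (diag_op E (\<lambda>e. sqrt (d e))) \<and>
      diag_op E (\<lambda>e. sqrt (d e)) \<circ> diag_op E (\<lambda>e. sqrt (d e)) = diag_op E d"
    using d by (simp add: positive_diag_op diag_op_compose[OF E] cong: diag_op_cong)
  fix S assume S: "positive_op S \<and> S \<circ> S = diag_op E d"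
  then have lin: "bounded_clinear S" and SS: "\<And>x. S (S x) = diag_op E d x"
    by (auto simp: positive_op_def fun_eq_iff)
  have sa: "cinner (S x) y = cinner x (S y)" for x y using S positive_op_selfadjoint by blast
  show "S = diag_op E (\<lambda>e. sqrt (d e))"
  proof (rule eq_diag_op[OF E lin])
    fix e assume e: "e \<in> E"
    define s where "s = sqrt (d e)"
    have s: "0 \<le> s" "s * s = d e" using d[OF e] by (auto simp: s_def)
    have SSe: "S (S e) = (s * s) *\<^sub>R e" by (simp add: SS diag_op_basis[OF E e] scaleR_scaleC s(2))
    show "S e = sqrt (d e) *\<^sub>R e"
    proof (cases "s = 0")
      case True
      have "cinner (S e) (S e) = cinner e (S (S e))" by (simp add: sa)
      then show ?thesis using True SSe by (simp add: cinner_self_eq_zero s_def)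
    next
      case False
      \<comment> \<open>From \<open>(S + s) (S - s) e = 0\<close>, the vector \<open>y\<close>
        satisfies \<open>S y = - s y\<close>, which positivity of \<open>S\<close> allows only for
        \<open>y = 0\<close>.\<close>
      define y where "y = S e - s *\<^sub>R e"
      have "S y = - s *\<^sub>R y"
        by (simp add: y_def bounded_clinear_diff[OF lin] bounded_clinear_scaleR[OF lin] SSe algebra_simps)
      then have "Re (cinner (S y) y) = - s * (norm y)\<^sup>2"
        by (simp add: cinner_simps cinner_self)
      moreover have "0 \<le> Re (cinner (S y) y)" using S by (simp add: positive_op_def)
      ultimately have "s * (norm y)\<^sup>2 \<le> 0" by simp
      then have "y = 0" using False s(1) by (simp add: mult_le_0_iff)
      then show ?thesis by (simp add: y_def s_def)
    qed
  qed
qed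

lemma abs_op_diag_op:
  assumes "finite_basis E"
  shows "abs_op (diag_op E d) = diag_op E (\<lambda>e. \<bar>d e\<bar>)"
  unfolding abs_op_def by (simp add: adj_diag_op diag_op_compose[OF assms] sqrt_op_diag_op[OF assms])

text \<open>This turns the squares of absolute values in the hypothesis into
  \<open>adj T \<circ> T\<close>, whose trace is the squared Hilbert-Schmidt norm.\<close>

lemma abs_op_square:
  fixes T :: "'a::complex_hilbert_space \<Rightarrow> 'a" and E :: "'a set"
  assumes E: "finite_basis E" and T: "bounded_clinear T"
  shows "abs_op T \<circ> abs_op T = adj T \<circ> T"
proof -
  note adjT = adj_bounded_clinear_cinner[OF E T]
  have "cinner (adj T (T x)) x = of_real ((norm (T x))\<^sup>2)" for x
    by (subst cinner_commute) (simp flip: adjT(2) add: cinner_self)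
  then have "positive_op (adj T \<circ> T)"
    by (simp add: positive_op_def bounded_clinear_compose[OF adjT(1) T])
  then obtain F d where F: "finite_basis F" "adj T \<circ> T = diag_op F d" "\<And>e. e \<in> F \<Longrightarrow> 0 \<le> d e"
    by (rule positive_op_eigenbasis[OF E]) blast
  then show ?thesis
    by (simp add: abs_op_def sqrt_op_diag_op diag_op_compose cong: diag_op_cong)
qed

text \<open>Basis independence: insert the chosen basis \<open>F\<close> by Parseval, swap the sums,
  move \<open>T\<close> to the other side by its adjoint, and remove \<open>E\<close> by
  Parseval.\<close>

lemma op_trace_eq:
  fixes T :: "'a::complex_hilbert_space \<Rightarrow> 'a" and E :: "'a set"
  assumes E: "finite_basis E" and T: "bounded_clinear T"
  shows "op_trace T = (\<Sum>e\<in>E. cinner (T e) e)"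
proof -
  define F :: "'a set" where "F = (SOME E. orthonormal_basis E)"
  have "orthonormal_basis F" unfolding F_def
    by (rule someI[of _ E]) (use E in \<open>simp add: finite_basis_def\<close>)
  then have F: "finite_basis F" by (rule finite_basis_any[OF E])
  note adjT = adj_bounded_clinear_cinner(2)[OF E T]
  have "(\<Sum>e\<in>E. cinner (T e) e) = (\<Sum>e\<in>E. \<Sum>f\<in>F. cinner (T e) f * cinner f e)"
    by (simp add: finite_basis_parseval[OF F])
  also have "\<dots> = (\<Sum>f\<in>F. \<Sum>e\<in>E. cinner f e * cinner e (adj T f))"
    by (subst sum.swap) (simp add: adjT mult.commute)
  also have "\<dots> = (\<Sum>f\<in>F. cinner (T f) f)"
    by (simp add: finite_basis_parseval[OF E] adjT)
  finally show ?thesis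
    using finite_basis_finite[OF F] by (simp add: op_trace_def F_def[symmetric])
qed

text \<open>An invertible positive operator is bounded below, so a finite trace leaves room for only
  finitely many basis vectors.\<close>

lemma invertible_density_op_finite_basis:
  fixes P :: "'a::complex_hilbert_space \<Rightarrow> 'a"
  assumes P: "density_op P" and inv: "invertible_op P"
  obtains E :: "'a set" where "finite_basis E"
proof -
  define E :: "'a set" where "E = (SOME E. orthonormal_basis E)"
  have E: "orthonormal_basis E" unfolding E_def
    using P by (intro someI_ex[of orthonormal_basis]) (auto simp: density_op_def trace_class_def)
  have pos: "positive_op P" and lin: "bounded_clinear P"
    using P by (auto simp: density_op_def positive_op_def)
  have "infsum (\<lambda>e. cinner (P e) e) E = 1"
    using P by (simp add: density_op_def op_trace_def E_def)
  \<comment> \<open>A sum that does not exist has the default value 0, so the value 1 certifies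
    summability.\<close>
  then have "(\<lambda>e. cinner (P e) e) summable_on E"
    by (metis infsum_not_exists zero_neq_one)
  then have summ: "(\<lambda>e. Re (cinner (P e) e)) summable_on E" by (rule summable_on_Re)
  obtain S where S: "bounded_clinear S" "S \<circ> P = id" using inv by (auto simp: invertible_op_def)
  obtain K where K: "K > 0" "\<And>x. norm (S x) \<le> norm x * K"
    using bounded_linear.pos_bounded[of S] S(1) unfolding bounded_clinear_def by blast
  obtain M where M: "M > 0" "\<And>x. norm (P x) \<le> norm x * M"
    using bounded_linear.pos_bounded[of P] lin unfolding bounded_clinear_def by blast
  \<comment> \<open>\<open>K\<close> bounds the inverse, so \<open>|P e| \<ge> 1 / K\<close>;
    together with \<open><P e, e> \<ge> |P e|^2 / M\<close> this gives \<open>c\<close>.\<close>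
  define c where "c = 1 / (K\<^sup>2 * M)"
  have c: "c > 0" using K M by (simp add: c_def)
  have ge: "c \<le> Re (cinner (P e) e)" if "e \<in> E" for e
  proof -
    have "cinner e e = 1" using E that by (simp add: orthonormal_basis_def)
    then have "norm e = 1" using that E orthonormal_norm[of E e]
      by (auto simp: orthonormal_basis_def orthonormal_def)
    moreover have "S (P e) = e" using S(2) by (simp add: fun_eq_iff)
    ultimately have "1 \<le> norm (P e) * K" using K(2)[of "P e"] by simp
    then have 1: "1 \<le> (norm (P e))\<^sup>2 * K\<^sup>2"
      by (metis one_le_power power_mult_distrib)
    \<comment> \<open>Positivity at this vector yields \<open><P e, e> \<ge> |P e|^2 / M\<close>,
      the inequality \<open>P^2 \<le> M P\<close>, without a square root of
      \<open>P\<close>.\<close>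
    let ?y = "e - (1/M) *\<^sub>R P e"
    have "0 \<le> Re (cinner (P ?y) ?y)" using pos by (simp add: positive_op_def)
    also have "cinner (P ?y) ?y = cinner (P e) e - of_real (2/M) * cinner (P e) (P e)
        + of_real (1/M * (1/M)) * cinner (P (P e)) (P e)"
      by (simp add: bounded_clinear_diff[OF lin] bounded_clinear_scaleR[OF lin] cinner_simps
          positive_op_selfadjoint[OF pos, of "P e" e] diff_divide_distrib)
    also have "Re \<dots> = Re (cinner (P e) e) - 2/M * (norm (P e))\<^sup>2 + 1/M * (1/M) * Re (cinner (P (P e)) (P e))"
      by (simp add: cinner_self)
    also have "\<dots> \<le> Re (cinner (P e) e) - 2/M * (norm (P e))\<^sup>2 + 1/M * (1/M) * (M * (norm (P e))\<^sup>2)"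
    proof -
      have "Re (cinner (P (P e)) (P e)) \<le> norm (P (P e)) * norm (P e)"
        using cmod_cinner_le[of "P (P e)" "P e"] complex_Re_le_cmod order_trans by blast
      also have "\<dots> \<le> (norm (P e) * M) * norm (P e)"
        by (intro mult_right_mono M) simp
      finally have "Re (cinner (P (P e)) (P e)) \<le> M * (norm (P e))\<^sup>2"
        by (simp add: power2_eq_square mult_ac)
      then show ?thesis using M(1) by (intro add_left_mono mult_left_mono) auto
    qed
    also have "\<dots> = Re (cinner (P e) e) - (norm (P e))\<^sup>2 / M" using M(1) by (simp add: field_simps)
    finally have "(norm (P e))\<^sup>2 / M \<le> Re (cinner (P e) e)" by simp
    moreover have "c \<le> (norm (P e))\<^sup>2 / M"
      using 1 K M by (simp add: c_def field_simps)
    ultimately show ?thesis by linarith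
  qed
  have "finite E"
  proof (rule ccontr)
    assume inf: "infinite E"
    let ?s = "infsum (\<lambda>e. Re (cinner (P e) e)) E"
    obtain n :: nat where n: "?s < real n * c" using reals_Archimedean3[OF c] by blast
    obtain F where F: "finite F" "card F = n" "F \<subseteq> E"
      using infinite_arbitrarily_large[OF inf, of n] by blast
    have "real n * c = (\<Sum>e\<in>F. c)" using F by simp
    also have "\<dots> \<le> (\<Sum>e\<in>F. Re (cinner (P e) e))" using F ge by (intro sum_mono) auto
    also have "\<dots> \<le> ?s"
      using ge c F summ by (intro finite_sum_le_infsum) (auto intro: order.trans[OF less_imp_le])
    finally show False using n by simp
  qed
  then show thesis using that E by (simp add: finite_basis_def)
qed

section \<open>The Araki transform in eigenbases\<close>

text \<open>On a finite spectrum the interpolating polynomial, taken as a constant sequence,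
  approximates \<open>g\<close> with error 0. The induction is Newton's: correct at the new node by
  a polynomial vanishing at the old ones.\<close>

lemma polynomial_interpolation:
  fixes g :: "'b::field \<Rightarrow> 'b"
  assumes "finite A"
  shows "\<exists>c. \<forall>a\<in>A. poly c a = g a"
  using assms
proof induction
  case (insert b A)
  then obtain c where c: "\<And>a. a \<in> A \<Longrightarrow> poly c a = g a" by blast
  let ?w = "\<Prod>a\<in>A. [:- a, 1:]"
  have w: "poly ?w a = (\<Prod>a'\<in>A. a - a')" for a by (simp add: poly_prod)
  have "poly ?w b \<noteq> 0" using insert by (auto simp: w)
  moreover have "poly ?w a = 0" if "a \<in> A" for a using insert that by (auto simp: w)
  ultimately have "\<forall>a\<in>insert b A. poly (c + smult ((g b - poly c b) / poly ?w b) ?w) a = g a"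
    using c by auto
  then show ?case by blast
qed simp

text \<open>The operators in view are \<open>diag_op U q\<close> for \<open>Q\<close> and
  \<open>diag_op V p\<close> for \<open>P\<close>. An operator \<open>T\<close> is described by the
  entries \<open><T v, u>\<close>, with inputs from \<open>V\<close> and outputs from
  \<open>U\<close>.\<close>

locale two_bases =
  fixes U V :: "'a::complex_hilbert_space set" and q p :: "'a \<Rightarrow> real"
  assumes U: "finite_basis U" and V: "finite_basis V"
    and p_pos: "v \<in> V \<Longrightarrow> 0 < p v"
begin

section \<open>Hilbert-Schmidt operators as matrices\<close>

lemma hilbert_schmidt_iff: "hilbert_schmidt (T::'a \<Rightarrow> 'a) \<longleftrightarrow> bounded_clinear T"
  using U by (auto simp: hilbert_schmidt_def finite_basis_def)

lemma operator_eqI: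
  assumes "bounded_clinear S" "bounded_clinear T"
    and "\<And>u v. u \<in> U \<Longrightarrow> v \<in> V \<Longrightarrow> cinner (S v) u = cinner (T v) u"
  shows "S = T"
  using assms by (intro bounded_clinear_eqI[OF V] finite_basis_vec_eqI[OF U])

lemma hs_norm_eq:
  fixes T :: "'a \<Rightarrow> 'a"
  assumes T: "bounded_clinear T"
  shows "hs_norm T = sqrt (\<Sum>v\<in>V. \<Sum>u\<in>U. (cmod (cinner (T v) u))\<^sup>2)"
proof -
  note adjT = adj_bounded_clinear_cinner[OF U T]
  have "cinner (adj T (T v)) v = of_real ((norm (T v))\<^sup>2)" for v
    by (subst cinner_commute) (simp flip: adjT(2) add: cinner_self)
  then show ?thesis
    by (simp add: hs_norm_def hs_inner_def op_trace_eq[OF V bounded_clinear_compose[OF adjT(1) T]]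
        finite_basis_norm_sq[OF U])
qed

lemma hs_norm_nonneg: "0 \<le> hs_norm T" if "bounded_clinear (T::'a \<Rightarrow> 'a)"
  by (simp add: hs_norm_eq[OF that] sum_nonneg)

lemma hs_norm_eq_zero:
  fixes T :: "'a \<Rightarrow> 'a"
  assumes T: "bounded_clinear T" and "hs_norm T = 0"
  shows "T x = 0"
proof -
  have "bounded_clinear (\<lambda>x::'a. 0::'a)" by (simp add: bounded_clinear_def)
  moreover have "(\<Sum>v\<in>V. \<Sum>u\<in>U. (cmod (cinner (T v) u))\<^sup>2) = 0"
    using assms by (simp add: hs_norm_eq)
  then have "cinner (T v) u = 0" if "u \<in> U" "v \<in> V" for u v
    using that finite_basis_finite[OF U] finite_basis_finite[OF V]
    by (simp add: sum_nonneg_eq_0_iff sum_nonneg)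
  ultimately have "T = (\<lambda>x. 0)" using T by (intro operator_eqI) auto
  then show ?thesis by simp
qed

text \<open>The matrix units \<open>x \<mapsto> <x, v> u\<close> diagonalise left multiplication by
  \<open>diag_op U a\<close> and right multiplication by \<open>diag_op V b\<close> at once, so such
  maps and their resolvents all have this form.\<close>

definition multiplier :: "('a \<Rightarrow> 'a \<Rightarrow> complex) \<Rightarrow> ('a \<Rightarrow> 'a) \<Rightarrow> 'a \<Rightarrow> 'a" where
  "multiplier h T x = (\<Sum>u\<in>U. \<Sum>v\<in>V. (h u v * cinner (T v) u * cinner x v) *\<^sub>C u)"

lemma multiplier_clinear: "bounded_clinear (multiplier h T)"
  unfolding multiplier_def[abs_def] by (intro bounded_clinear_setsum bounded_clinear_rank_one)

lemma multiplier_coef: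
  assumes u: "u \<in> U" and v: "v \<in> V"
  shows "cinner (multiplier h T v) u = h u v * cinner (T v) u"
proof -
  have "cinner (multiplier h T v) u
      = (\<Sum>u'\<in>U. \<Sum>v'\<in>V. h u' v' * cinner (T v') u' * cinner v v' * cinner u' u)"
    by (simp add: multiplier_def cinner_simps)
  also have "\<dots> = (\<Sum>u'\<in>U. \<Sum>v'\<in>V. if v' = v then if u' = u then h u v * cinner (T v) u else 0 else 0)"
    by (intro sum.cong refl) (auto simp: finite_basis_cinner[OF U _ u] finite_basis_cinner[OF V v])
  also have "\<dots> = h u v * cinner (T v) u"
    using u v finite_basis_finite[OF U] finite_basis_finite[OF V] by simp
  finally show ?thesis .
qed

lemma multiplier_eqI:
  assumes "bounded_clinear S"
    and "\<And>u v. u \<in> U \<Longrightarrow> v \<in> V \<Longrightarrow> cinner (S v) u = h u v * cinner (T v) u"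
  shows "S = multiplier h T"
  using assms by (intro operator_eqI multiplier_clinear) (simp_all add: multiplier_coef)

lemma hs_norm_multiplier_le:
  assumes T: "bounded_clinear T" and h: "\<And>u v. u \<in> U \<Longrightarrow> v \<in> V \<Longrightarrow> cmod (h u v) \<le> K"
    and K: "0 \<le> K"
  shows "hs_norm (multiplier h T) \<le> K * hs_norm T"
proof -
  have "(\<Sum>v\<in>V. \<Sum>u\<in>U. (cmod (cinner (multiplier h T v) u))\<^sup>2)
      \<le> (\<Sum>v\<in>V. \<Sum>u\<in>U. K\<^sup>2 * (cmod (cinner (T v) u))\<^sup>2)"
    using h by (intro sum_mono) (simp add: multiplier_coef norm_mult power_mult_distrib mult_right_mono power_mono)
  also have "\<dots> = K\<^sup>2 * (\<Sum>v\<in>V. \<Sum>u\<in>U. (cmod (cinner (T v) u))\<^sup>2)"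
    by (simp add: sum_distrib_left)
  finally have "hs_norm (multiplier h T) \<le> sqrt (K\<^sup>2 * (\<Sum>v\<in>V. \<Sum>u\<in>U. (cmod (cinner (T v) u))\<^sup>2))"
    by (simp add: hs_norm_eq[OF multiplier_clinear])
  then show ?thesis using K by (simp add: hs_norm_eq[OF T] real_sqrt_mult)
qed

lemma hs_bounded_multiplier: "hs_bounded (multiplier h)"
proof -
  have fin: "finite ((\<lambda>(u, v). cmod (h u v)) ` (U \<times> V))"
    using finite_basis_finite[OF U] finite_basis_finite[OF V] by simp
  \<comment> \<open>The extra 0 makes the set nonempty and \<open>K\<close> nonnegative.\<close>
  define K where "K = Max (insert 0 ((\<lambda>(u, v). cmod (h u v)) ` (U \<times> V)))"
  have K: "0 \<le> K" "\<And>u v. u \<in> U \<Longrightarrow> v \<in> V \<Longrightarrow> cmod (h u v) \<le> K"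
    unfolding K_def using fin by (auto intro!: Max_ge)
  have "multiplier h (\<lambda>x. S x + T x) = (\<lambda>x. multiplier h S x + multiplier h T x)"
    if "bounded_clinear S" "bounded_clinear T" for S T
    using that by (intro operator_eqI multiplier_clinear bounded_clinear_plus)
      (simp_all add: multiplier_coef cinner_simps algebra_simps)
  moreover have "multiplier h (\<lambda>x. c *\<^sub>C T x) = (\<lambda>x. c *\<^sub>C multiplier h T x)"
    if "bounded_clinear T" for c T
    using that by (intro operator_eqI multiplier_clinear bounded_clinear_scaled)
      (simp_all add: multiplier_coef cinner_simps algebra_simps)
  moreover have "\<forall>T. bounded_clinear T \<longrightarrow> hs_norm (multiplier h T) \<le> K * hs_norm T"
    using K by (intro allI impI hs_norm_multiplier_le)
  ultimately show ?thesis
    unfolding hs_bounded_def hilbert_schmidt_iff by (auto simp: multiplier_clinear)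
qed

section \<open>Spectrum and functional calculus of the Araki transform\<close>

definition ratio :: "'a \<Rightarrow> 'a \<Rightarrow> real" where
  "ratio u v = q u / p v"

definition ratios :: "real set" where
  "ratios = (\<lambda>(u, v). ratio u v) ` (U \<times> V)"

lemma finite_ratios: "finite ratios"
  using finite_basis_finite[OF U] finite_basis_finite[OF V] by (simp add: ratios_def)

lemma ratio_in_ratios: "u \<in> U \<Longrightarrow> v \<in> V \<Longrightarrow> ratio u v \<in> ratios"
  by (auto simp: ratios_def)

lemma inv_diag_op: "inv (diag_op V p) = diag_op V (\<lambda>v. inverse (p v))"
proof (rule inv_unique_comp)
  have "p v \<noteq> 0" if "v \<in> V" for v using p_pos[OF that] by simp
  then show "diag_op V p \<circ> diag_op V (\<lambda>v. inverse (p v)) = id"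
    "diag_op V (\<lambda>v. inverse (p v)) \<circ> diag_op V p = id"
    by (simp_all add: diag_op_compose[OF V] diag_op_one[OF V, symmetric] cong: diag_op_cong)
qed

lemma two_sided_multiplier:
  assumes T: "bounded_clinear T"
  shows "diag_op U a \<circ> T \<circ> diag_op V b = multiplier (\<lambda>u v. of_real (a u * b v)) T"
proof (rule multiplier_eqI)
  show "bounded_clinear (diag_op U a \<circ> T \<circ> diag_op V b)"
    by (intro bounded_clinear_compose diag_op_clinear T)
qed (simp add: cinner_diag_op[OF U] diag_op_basis[OF V] bounded_clinear_scaleC[OF T] cinner_simps)

lemma araki_eq_multiplier:
  assumes "bounded_clinear T"
  shows "araki (diag_op U q) (diag_op V p) T = multiplier (\<lambda>u v. of_real (ratio u v)) T"
  by (simp add: araki_def inv_diag_op two_sided_multiplier[OF assms] ratio_def divide_inverse)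

lemma araki_power:
  assumes "bounded_clinear T"
  shows "(araki (diag_op U q) (diag_op V p) ^^ i) T = multiplier (\<lambda>u v. of_real (ratio u v ^ i)) T"
proof (induction i)
  case 0
  show ?case using assms by (intro multiplier_eqI) simp_all
next
  case (Suc i)
  show ?case
    by (rule multiplier_eqI)
      (simp_all add: Suc araki_eq_multiplier[OF multiplier_clinear] multiplier_clinear multiplier_coef)
qed

lemma hs_poly_araki:
  assumes "bounded_clinear T"
  shows "hs_poly c (araki (diag_op U q) (diag_op V p)) T = multiplier (\<lambda>u v. of_real (poly c (ratio u v))) T"
proof (rule multiplier_eqI)
  show "bounded_clinear (hs_poly c (araki (diag_op U q) (diag_op V p)) T)"
    unfolding hs_poly_def scaleR_scaleC araki_power[OF assms]
    by (intro bounded_clinear_setsum bounded_clinear_scaled multiplier_clinear)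
qed (simp add: hs_poly_def araki_power[OF assms] cinner_simps multiplier_coef poly_altdef
    sum_distrib_right mult.assoc)

text \<open>Away from the ratios the resolvent is the multiplier with entries
  \<open>1 / (ratio u v - z)\<close>; at a ratio the matrix unit of \<open>u\<close> and
  \<open>v\<close> is an eigenvector.\<close>

lemma hs_spectrum_araki:
  "hs_spectrum (araki (diag_op U q) (diag_op V p)) = of_real ` ratios" (is "hs_spectrum ?A = _")
proof (intro equalityI subsetI)
  fix z assume z: "z \<in> hs_spectrum ?A"
  show "z \<in> of_real ` ratios"
  proof (rule ccontr)
    assume nz: "z \<notin> of_real ` ratios"
    define h where "h u v = inverse (of_real (ratio u v) - z)" for u v
    have "of_real (ratio u v) - z \<noteq> 0" if "u \<in> U" "v \<in> V" for u v
      using nz ratio_in_ratios[OF that] by auto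
    then have inv: "h u v * (of_real (ratio u v) - z) = 1" if "u \<in> U" "v \<in> V" for u v
      using that by (simp add: h_def)
    have "multiplier h (\<lambda>x. ?A T x - z *\<^sub>C T x) = T \<and>
        (\<lambda>x. ?A (multiplier h T) x - z *\<^sub>C multiplier h T x) = T" if T: "bounded_clinear T" for T
    proof
      have "h u v * ((of_real (ratio u v) - z) * y) = y" if "u \<in> U" "v \<in> V" for u v y
        using inv[OF that] by (simp flip: mult.assoc)
      then show "multiplier h (\<lambda>x. ?A T x - z *\<^sub>C T x) = T"
        by (intro operator_eqI multiplier_clinear T)
          (simp add: multiplier_coef cinner_simps araki_eq_multiplier[OF T] flip: left_diff_distrib)
      have "(of_real (ratio u v) - z) * (h u v * y) = y" if "u \<in> U" "v \<in> V" for u v y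
        using inv[OF that] by (simp add: mult_ac flip: mult.assoc)
      then show "(\<lambda>x. ?A (multiplier h T) x - z *\<^sub>C multiplier h T x) = T"
        unfolding araki_eq_multiplier[OF multiplier_clinear]
        by (intro operator_eqI bounded_clinear_minus bounded_clinear_scaled multiplier_clinear T)
          (simp add: multiplier_coef cinner_simps flip: left_diff_distrib)
    qed
    then show False
      using z hs_bounded_multiplier[of h] unfolding hs_spectrum_def hilbert_schmidt_iff by blast
  qed
next
  fix z assume "z \<in> complex_of_real ` ratios"
  then obtain u v where uv: "u \<in> U" "v \<in> V" and z: "z = of_real (ratio u v)"
    by (auto simp: ratios_def)
  define T where "T x = (1 * cinner x v) *\<^sub>C u" for x
  have T: "bounded_clinear T" unfolding T_def[abs_def] by (rule bounded_clinear_rank_one)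
  have coef: "cinner (T v') u' = (if u' = u \<and> v' = v then 1 else 0)" if "u' \<in> U" "v' \<in> V" for u' v'
    using uv that by (auto simp: T_def cinner_simps finite_basis_cinner[OF U] finite_basis_cinner[OF V])
  \<comment> \<open>Writing the zero operator as a multiple of \<open>T\<close> lets homogeneity
    show that a candidate inverse sends it to 0.\<close>
  have null: "(\<lambda>x. ?A T x - z *\<^sub>C T x) = (\<lambda>x. 0 *\<^sub>C T x)"
    unfolding araki_eq_multiplier[OF T]
    by (intro operator_eqI bounded_clinear_minus bounded_clinear_scaled multiplier_clinear T)
      (simp add: multiplier_coef cinner_simps coef z)
  have "\<not> (hs_bounded \<Psi> \<and> \<Psi> (\<lambda>x. ?A T x - z *\<^sub>C T x) = T)" for \<Psi>
  proof
    assume *: "hs_bounded \<Psi> \<and> \<Psi> (\<lambda>x. ?A T x - z *\<^sub>C T x) = T"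
    then have "\<Psi> (\<lambda>x. 0 *\<^sub>C T x) = (\<lambda>x. 0 *\<^sub>C \<Psi> T x)"
      using T unfolding hs_bounded_def hilbert_schmidt_iff by blast
    then have "T = (\<lambda>x. 0)" using * null by simp
    then show False using coef[OF uv] by simp
  qed
  then show "z \<in> hs_spectrum ?A" using T unfolding hs_spectrum_def hilbert_schmidt_iff by blast
qed

text \<open>Existence: a multiplier is bounded by its largest entry, so uniform convergence on the
  ratios gives convergence in operator norm. Uniqueness: the constant interpolating sequence leaves
  no choice on bounded operators, and extensionality settles the other arguments.\<close>

lemma hs_fun_calc_araki:
  "hs_fun_calc g (araki (diag_op U q) (diag_op V p))
    = restrict (multiplier (\<lambda>u v. of_real (g (ratio u v)))) {T. bounded_clinear T}"
  (is "hs_fun_calc g ?A = restrict ?M _")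
  unfolding hs_fun_calc_def hilbert_schmidt_iff hs_spectrum_araki
proof (rule the_equality)
  have A: "{t. complex_of_real t \<in> of_real ` ratios} = ratios" by auto
  let ?lim = "\<lambda>c \<Psi>. \<forall>\<epsilon>>0. \<forall>\<^sub>F n in sequentially. \<forall>T. bounded_clinear T \<longrightarrow>
    hs_norm (\<lambda>x. hs_poly (c n) ?A T x - \<Psi> T x) \<le> \<epsilon> * hs_norm T"
  have lim: "?lim c (restrict ?M {T. bounded_clinear T})"
    if "uniform_limit ratios (\<lambda>n. poly (c n)) g sequentially" for c
  proof (intro allI impI)
    fix \<epsilon> :: real assume "\<epsilon> > 0"
    then have "\<forall>\<^sub>F n in sequentially. \<forall>t\<in>ratios. dist (poly (c n) t) (g t) < \<epsilon>"
      using that by (simp add: uniform_limit_iff)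
    then show "\<forall>\<^sub>F n in sequentially. \<forall>T. bounded_clinear T \<longrightarrow>
      hs_norm (\<lambda>x. hs_poly (c n) ?A T x - restrict ?M {T. bounded_clinear T} T x) \<le> \<epsilon> * hs_norm T"
    proof eventually_elim
      case (elim n)
      show ?case
      proof (intro allI impI)
        fix T :: "'a \<Rightarrow> 'a" assume T: "bounded_clinear T"
        have "(\<lambda>x. hs_poly (c n) ?A T x - restrict ?M {T. bounded_clinear T} T x)
            = multiplier (\<lambda>u v. of_real (poly (c n) (ratio u v) - g (ratio u v))) T"
          unfolding hs_poly_araki[OF T] using T
          by (intro multiplier_eqI)
            (simp_all add: bounded_clinear_minus multiplier_clinear multiplier_coef cinner_simps left_diff_distrib)
        then show "hs_norm (\<lambda>x. hs_poly (c n) ?A T x - restrict ?M {T. bounded_clinear T} T x) \<le> \<epsilon> * hs_norm T"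
          using elim \<open>\<epsilon> > 0\<close> ratio_in_ratios
          by (auto intro!: hs_norm_multiplier_le[OF T] simp: dist_real_def less_imp_le simp del: of_real_diff)
      qed
    qed
  qed
  have bdd: "hs_bounded (restrict ?M {T. bounded_clinear T})"
  proof -
    have "bounded_clinear (\<lambda>x. S x + T x)" if "bounded_clinear S" "bounded_clinear T" for S T :: "'a \<Rightarrow> 'a"
      using that by (rule bounded_clinear_plus)
    moreover have "bounded_clinear (\<lambda>x. c *\<^sub>C T x)" if "bounded_clinear T" for c and T :: "'a \<Rightarrow> 'a"
      using that by (rule bounded_clinear_scaled)
    ultimately show ?thesis
      using hs_bounded_multiplier[of "\<lambda>u v. of_real (g (ratio u v))"]
      unfolding hs_bounded_def hilbert_schmidt_iff by simp
  qed
  show "hs_bounded (restrict ?M {T. bounded_clinear T}) \<and>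
      restrict ?M {T. bounded_clinear T} \<in> extensional {T. bounded_clinear T} \<and>
      (\<forall>c. uniform_limit {t. complex_of_real t \<in> of_real ` ratios} (\<lambda>n. poly (c n)) g sequentially \<longrightarrow>
        ?lim c (restrict ?M {T. bounded_clinear T}))"
    unfolding A using bdd lim by blast
  fix \<Psi> :: "('a \<Rightarrow> 'a) \<Rightarrow> 'a \<Rightarrow> 'a"
  assume \<Psi>: "hs_bounded \<Psi> \<and> \<Psi> \<in> extensional {T. bounded_clinear T} \<and>
      (\<forall>c. uniform_limit {t. complex_of_real t \<in> of_real ` ratios} (\<lambda>n. poly (c n)) g sequentially \<longrightarrow> ?lim c \<Psi>)"
  obtain c where c: "\<And>t. t \<in> ratios \<Longrightarrow> poly c t = g t"
    using polynomial_interpolation[OF finite_ratios, of g] by blast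
  then have "uniform_limit ratios (\<lambda>n. poly c) g sequentially"
    by (simp add: uniform_limit_iff)
  then have "?lim (\<lambda>_. c) \<Psi>" using \<Psi>[THEN conjunct2, THEN conjunct2, THEN spec, of "\<lambda>_. c"] unfolding A by simp
  then have le: "hs_norm (\<lambda>x. hs_poly c ?A T x - \<Psi> T x) \<le> \<epsilon> * hs_norm T"
    if "bounded_clinear T" "\<epsilon> > 0" for \<epsilon> T using that by simp
  have "\<Psi> T = ?M T" if T: "bounded_clinear T" for T
  proof -
    have \<Psi>T: "bounded_clinear (\<Psi> T)" using \<Psi> T by (simp add: hs_bounded_def hilbert_schmidt_iff)
    have poly: "hs_poly c ?A T = ?M T"
      using ratio_in_ratios unfolding hs_poly_araki[OF T]
      by (intro multiplier_eqI multiplier_clinear) (simp add: multiplier_coef c)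
    let ?D = "\<lambda>x. hs_poly c ?A T x - \<Psi> T x"
    have D: "bounded_clinear ?D" unfolding poly by (intro bounded_clinear_minus multiplier_clinear \<Psi>T)
    have "hs_norm ?D \<le> 0 + e" if "e > 0" for e
    proof -
      \<comment> \<open>Dividing by \<open>1 + hs_norm T\<close> avoids a case split on
        \<open>hs_norm T = 0\<close>.\<close>
      have "hs_norm ?D \<le> e / (1 + hs_norm T) * hs_norm T"
        using that hs_norm_nonneg[OF T] by (intro le[OF T]) simp
      also have "\<dots> \<le> e" using that hs_norm_nonneg[OF T] by (simp add: field_simps)
      finally show ?thesis by simp
    qed
    then have "hs_norm ?D \<le> 0" by (rule field_le_epsilon)
    then have "hs_norm ?D = 0" using hs_norm_nonneg[OF D] by simp
    from hs_norm_eq_zero[OF D this] show ?thesis by (auto simp: poly fun_eq_iff)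
  qed
  then show "\<Psi> = restrict ?M {T. bounded_clinear T}"
    using \<Psi> by (intro extensionalityI[of _ "{T. bounded_clinear T}"]) auto
qed

text \<open>Together with \<open>weight u v * ratio u v\<close>, which is
  \<open>q u * |<u, v>|^2\<close>, this is the Nussbaum-Szkola pair of distributions attached to
  \<open>P\<close> and \<open>Q\<close>; \<open>ratio\<close> is their likelihood ratio.\<close>

definition weight :: "'a \<Rightarrow> 'a \<Rightarrow> real" where
  "weight u v = p v * (cmod (cinner v u))\<^sup>2"

lemma sqrt_op_P: "sqrt_op (diag_op V p) = diag_op V (\<lambda>v. sqrt (p v))"
  using p_pos by (intro sqrt_op_diag_op[OF V]) (simp add: less_imp_le)

text \<open>The two copies of \<open>sqrt_op P\<close> in the inner product contribute
  \<open>sqrt (p v)\<close> each, and the change from \<open>V\<close> to \<open>U\<close> and back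
  contributes \<open>|<v, u>|^2\<close>.\<close>

lemma divergence_eq:
  "divergence g (diag_op U q) (diag_op V p) = (\<Sum>v\<in>V. \<Sum>u\<in>U. weight u v * g (ratio u v))"
proof -
  let ?S = "diag_op V (\<lambda>v. sqrt (p v))"
  let ?M = "multiplier (\<lambda>u v. of_real (g (ratio u v)))"
  have "cinner (?S (?M ?S v)) v = of_real (\<Sum>u\<in>U. weight u v * g (ratio u v))" if v: "v \<in> V" for v
  proof -
    have "cinner (?S (?M ?S v)) v = of_real (sqrt (p v)) * cinner (?M ?S v) v"
      by (rule cinner_diag_op[OF V v])
    also have "cinner (?M ?S v) v = (\<Sum>u\<in>U. cinner (?M ?S v) u * cinner u v)"
      by (simp add: finite_basis_parseval[OF U])
    also have "\<dots> = (\<Sum>u\<in>U. of_real (g (ratio u v) * sqrt (p v)) * (cinner v u * cinner u v))"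
      using v by (intro sum.cong refl)
        (simp add: multiplier_coef diag_op_basis[OF V] cinner_simps mult_ac)
    also have "of_real (sqrt (p v)) * \<dots>
        = of_real (\<Sum>u\<in>U. p v * (cmod (cinner v u))\<^sup>2 * g (ratio u v))"
    proof -
      have ss: "of_real (sqrt (p v)) * (of_real (sqrt (p v)) * y) = of_real (p v) * (y::complex)" for y
        using p_pos[OF v] by (simp flip: mult.assoc of_real_mult)
      show ?thesis
        unfolding cinner_mult_commute by (simp add: sum_distrib_left ss mult_ac)
    qed
    finally show ?thesis by (simp add: weight_def)
  qed
  then show ?thesis
    by (simp add: divergence_def hs_inner_def sqrt_op_P adj_diag_op hs_fun_calc_araki diag_op_clinear
        op_trace_eq[OF V bounded_clinear_compose[OF diag_op_clinear multiplier_clinear]])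
qed

lemma op_trace_diag_op:
  assumes "finite_basis E"
  shows "op_trace (diag_op E d :: 'a \<Rightarrow> 'a) = of_real (\<Sum>e\<in>E. d e)"
proof -
  have "cinner (diag_op E d e) e = of_real (d e)" if "e \<in> E" for e
    using that by (simp add: cinner_diag_op[OF assms] finite_basis_cinner[OF assms])
  then show ?thesis by (simp add: op_trace_eq[OF assms diag_op_clinear])
qed

lemma sum_weight: "(\<Sum>v\<in>V. \<Sum>u\<in>U. weight u v) = (\<Sum>v\<in>V. p v)"
  by (simp add: weight_def finite_basis_norm_sq[OF U] finite_basis_norm[OF V] flip: sum_distrib_left)

lemma weight_ratio: "v \<in> V \<Longrightarrow> weight u v * ratio u v = q u * (cmod (cinner u v))\<^sup>2"
  using p_pos[of v] by (simp add: weight_def ratio_def cmod_cinner_commute[of v])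

lemma sum_weight_ratio: "(\<Sum>v\<in>V. \<Sum>u\<in>U. weight u v * ratio u v) = (\<Sum>u\<in>U. q u)"
proof -
  have "(\<Sum>v\<in>V. \<Sum>u\<in>U. weight u v * ratio u v) = (\<Sum>v\<in>V. \<Sum>u\<in>U. q u * (cmod (cinner u v))\<^sup>2)"
    by (intro sum.cong refl weight_ratio)
  also have "\<dots> = (\<Sum>u\<in>U. q u * (\<Sum>v\<in>V. (cmod (cinner u v))\<^sup>2))"
    by (subst sum.swap) (simp add: sum_distrib_left)
  finally show ?thesis by (simp add: finite_basis_norm_sq[OF V] finite_basis_norm[OF U])
qed

text \<open>In the basis \<open>V\<close> the trace of \<open>Q^2 P^-1\<close> has terms
  \<open>q^2 / p * |<v, u>|^2\<close>, and \<open>q^2 / p = p * (q / p)^2\<close> makes it the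
  second moment of the ratio.\<close>

lemma chi_distance_eq:
  "chi_distance (diag_op U q) (diag_op V p) = sqrt ((\<Sum>v\<in>V. \<Sum>u\<in>U. weight u v * (ratio u v)\<^sup>2) - 1)"
proof -
  let ?Q = "diag_op U (\<lambda>u. q u * q u)" and ?R = "diag_op V (\<lambda>v. inverse (p v))"
  have "cinner ((?Q \<circ> ?R) v) v = of_real (\<Sum>u\<in>U. weight u v * (ratio u v)\<^sup>2)" if v: "v \<in> V" for v
  proof -
    have "cinner ((?Q \<circ> ?R) v) v = of_real (inverse (p v)) * cinner (?Q v) v"
      by (simp add: diag_op_basis[OF V v] bounded_clinear_scaleC[OF diag_op_clinear] cinner_simps)
    also have "\<dots> = of_real (\<Sum>u\<in>U. inverse (p v) * (q u * q u * (cmod (cinner v u))\<^sup>2))"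
      by (simp only: cinner_diag_op_self of_real_mult[symmetric] sum_distrib_left)
    also have "(\<Sum>u\<in>U. inverse (p v) * (q u * q u * (cmod (cinner v u))\<^sup>2))
        = (\<Sum>u\<in>U. weight u v * (ratio u v)\<^sup>2)"
      using p_pos[OF v] by (intro sum.cong refl) (simp add: weight_def ratio_def power2_eq_square field_simps)
    finally show ?thesis .
  qed
  then show ?thesis
    by (simp add: chi_distance_def diag_op_compose[OF U] inv_diag_op
        op_trace_eq[OF V bounded_clinear_compose[OF diag_op_clinear diag_op_clinear]] del: comp_apply)
qed

text \<open>Duality: \<open>tr |D| = tr (Z D)\<close> for the sign \<open>Z\<close> of
  \<open>D = Q - P\<close>. Expanding this in \<open>V\<close> and \<open>U\<close> and applying
  Cauchy-Schwarz with weights \<open>p v\<close> leaves the centred second moment of the ratio times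
  a factor at most 1.\<close>

lemma trace_norm_distance_le:
  assumes p1: "(\<Sum>v\<in>V. p v) = 1"
  shows "trace_norm_distance (diag_op U q) (diag_op V p)
    \<le> sqrt (\<Sum>v\<in>V. \<Sum>u\<in>U. weight u v * (ratio u v - 1)\<^sup>2)"
    and "0 \<le> trace_norm_distance (diag_op U q) (diag_op V p)"
proof -
  define D where "D = (\<lambda>x. diag_op U q x - diag_op V p x)"
  have D: "bounded_clinear D" unfolding D_def by (intro bounded_clinear_minus diag_op_clinear)
  have "cinner (D x) y = cinner x (D y)" for x y
    by (simp add: D_def cinner_simps diag_op_selfadjoint)
  then obtain W d where W: "finite_basis W" and "\<And>w. w \<in> W \<Longrightarrow> D w = (d w::real) *\<^sub>R w"
    using selfadjoint_eigenbasis[OF U D] by blast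
  then have DW: "D = diag_op W d" by (intro eq_diag_op D)
  have tn: "trace_norm_distance (diag_op U q) (diag_op V p) = (\<Sum>w\<in>W. \<bar>d w\<bar>)"
    unfolding trace_norm_distance_def D_def[symmetric]
    by (simp add: DW abs_op_diag_op[OF W] op_trace_diag_op[OF W])
  then show "0 \<le> trace_norm_distance (diag_op U q) (diag_op V p)" by (simp add: sum_nonneg)
  \<comment> \<open>As \<open>sgn 0 = 0\<close>, this \<open>Z\<close> need not be unitary; being a
    contraction suffices.\<close>
  define Z where "Z = diag_op W (\<lambda>w. sgn (d w))"
  have Z_le: "L2_set (\<lambda>(v, u). sqrt (p v) * cmod (cinner (Z v) u)) (V \<times> U) \<le> 1"
  proof -
    have "(\<Sum>v\<in>V. \<Sum>u\<in>U. (sqrt (p v) * cmod (cinner (Z v) u))\<^sup>2) = (\<Sum>v\<in>V. p v * (norm (Z v))\<^sup>2)"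
      using p_pos by (intro sum.cong refl)
        (simp add: power_mult_distrib less_imp_le finite_basis_norm_sq[OF U] flip: sum_distrib_left)
    also have "\<dots> \<le> (\<Sum>v\<in>V. p v * 1)"
    proof (intro sum_mono mult_left_mono)
      fix v assume v: "v \<in> V"
      have "(norm (Z v))\<^sup>2 = (\<Sum>w\<in>W. (cmod (cinner (Z v) w))\<^sup>2)"
        by (simp add: finite_basis_norm_sq[OF W])
      also have "\<dots> \<le> (\<Sum>w\<in>W. (cmod (cinner v w))\<^sup>2)"
        by (intro sum_mono power_mono)
          (auto simp: Z_def cinner_diag_op[OF W] norm_mult sgn_if)
      finally show "(norm (Z v))\<^sup>2 \<le> 1"
        by (simp add: finite_basis_norm_sq[OF W] finite_basis_norm[OF V v])
      show "0 \<le> p v" using p_pos[OF v] by simp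
    qed
    finally show ?thesis
      using p1 by (simp add: L2_set_def sum.cartesian_product case_prod_beta)
  qed
  have "of_real (\<Sum>w\<in>W. \<bar>d w\<bar>) = op_trace (Z \<circ> D)"
    by (simp add: Z_def DW diag_op_compose[OF W] op_trace_diag_op[OF W] abs_sgn mult.commute)
  also have "\<dots> = (\<Sum>v\<in>V. cinner (D v) (Z v))"
    by (simp add: op_trace_eq[OF V] bounded_clinear_compose[OF diag_op_clinear D] Z_def diag_op_selfadjoint)
  also have "\<dots> = (\<Sum>v\<in>V. \<Sum>u\<in>U. cinner (D v) u * cinner u (Z v))"
    by (simp add: finite_basis_parseval[OF U])
  finally have "cmod (of_real (\<Sum>w\<in>W. \<bar>d w\<bar>)) = cmod (\<Sum>v\<in>V. \<Sum>u\<in>U. cinner (D v) u * cinner u (Z v))"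
    by (rule arg_cong)
  then have "(\<Sum>w\<in>W. \<bar>d w\<bar>) = cmod (\<Sum>v\<in>V. \<Sum>u\<in>U. cinner (D v) u * cinner u (Z v))"
    unfolding norm_of_real by (simp add: sum_nonneg)
  also have "\<dots> \<le> (\<Sum>v\<in>V. \<Sum>u\<in>U. cmod (cinner (D v) u * cinner u (Z v)))"
    by (intro order.trans[OF norm_sum] sum_mono norm_sum)
  \<comment> \<open>The entry of \<open>D\<close> is \<open>(q u - p v) * <v, u>\<close> with
    \<open>q u - p v = p v * (ratio u v - 1)\<close>; the factor \<open>p v\<close> is shared
    equally between the two sides.\<close>
  also have "\<dots> = (\<Sum>v\<in>V. \<Sum>u\<in>U. \<bar>sqrt (p v) * (ratio u v - 1) * cmod (cinner v u)\<bar>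
      * \<bar>sqrt (p v) * cmod (cinner (Z v) u)\<bar>)"
  proof (intro sum.cong refl)
    fix u v assume u: "u \<in> U" and v: "v \<in> V"
    have "cinner (D v) u = of_real (q u - p v) * cinner v u"
      by (simp add: D_def cinner_simps cinner_diag_op[OF U u] diag_op_basis[OF V v] algebra_simps)
    then have "cmod (cinner (D v) u * cinner u (Z v)) = \<bar>q u - p v\<bar> * cmod (cinner v u) * cmod (cinner (Z v) u)"
      by (simp add: norm_mult cmod_cinner_commute[of u] del: of_real_diff)
    also have "\<bar>q u - p v\<bar> = sqrt (p v) * sqrt (p v) * \<bar>ratio u v - 1\<bar>"
    proof -
      have "q u - p v = p v * (ratio u v - 1)" using p_pos[OF v] by (simp add: ratio_def field_simps)
      then show ?thesis using p_pos[OF v] by (simp add: abs_mult)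
    qed
    finally show "cmod (cinner (D v) u * cinner u (Z v))
        = \<bar>sqrt (p v) * (ratio u v - 1) * cmod (cinner v u)\<bar> * \<bar>sqrt (p v) * cmod (cinner (Z v) u)\<bar>"
      using p_pos[OF v] by (simp add: abs_mult mult_ac)
  qed
  also have "\<dots> \<le> L2_set (\<lambda>(v, u). sqrt (p v) * (ratio u v - 1) * cmod (cinner v u)) (V \<times> U)
      * L2_set (\<lambda>(v, u). sqrt (p v) * cmod (cinner (Z v) u)) (V \<times> U)"
    using L2_set_mult_ineq[where A = "V \<times> U" and f = "\<lambda>(v, u). sqrt (p v) * (ratio u v - 1) * cmod (cinner v u)"
        and g = "\<lambda>(v, u). sqrt (p v) * cmod (cinner (Z v) u)"]
    by (simp add: sum.cartesian_product case_prod_beta)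
  also have "L2_set (\<lambda>(v, u). sqrt (p v) * (ratio u v - 1) * cmod (cinner v u)) (V \<times> U)
      = sqrt (\<Sum>v\<in>V. \<Sum>u\<in>U. weight u v * (ratio u v - 1)\<^sup>2)"
    using p_pos unfolding L2_set_def sum.cartesian_product
    by (intro arg_cong[of _ _ sqrt] sum.cong refl) (auto simp: weight_def power_mult_distrib mult_ac less_imp_le)
  also have "\<dots> * L2_set (\<lambda>(v, u). sqrt (p v) * cmod (cinner (Z v) u)) (V \<times> U) \<le> \<dots> * 1"
    by (intro mult_left_mono Z_le real_sqrt_ge_zero sum_nonneg mult_nonneg_nonneg zero_le_power2)
      (auto simp: weight_def p_pos less_imp_le)
  finally show "trace_norm_distance (diag_op U q) (diag_op V p)
    \<le> sqrt (\<Sum>v\<in>V. \<Sum>u\<in>U. weight u v * (ratio u v - 1)\<^sup>2)"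
    unfolding tn by simp
qed

text \<open>The matrix unit of \<open>u\<close> and \<open>v\<close> has a single nonzero entry,
  which the two-sided multiplication scales by \<open>sqrt (ratio u v)\<close>.\<close>

lemma rank_one_ratio:
  assumes q: "\<And>u. u \<in> U \<Longrightarrow> 0 \<le> q u" and u: "u \<in> U" and v: "v \<in> V"
  obtains T where "hilbert_schmidt T" "Re (op_trace (abs_op T \<circ> abs_op T)) = 1"
    and "Re (op_trace (abs_op (sqrt_op (diag_op U q) \<circ> T \<circ> sqrt_op (inv (diag_op V p))) \<circ>
                       abs_op (sqrt_op (diag_op U q) \<circ> T \<circ> sqrt_op (inv (diag_op V p))))) = ratio u v"
proof
  define T where "T x = (1 * cinner x v) *\<^sub>C u" for x
  have T: "bounded_clinear T" unfolding T_def[abs_def] by (rule bounded_clinear_rank_one)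
  have coef: "cinner (T v') u' = (if u' = u then if v' = v then 1 else 0 else 0)" if "u' \<in> U" "v' \<in> V" for u' v'
    using u v that by (auto simp: T_def cinner_simps finite_basis_cinner[OF U] finite_basis_cinner[OF V])
  have HS: "Re (op_trace (abs_op S \<circ> abs_op S)) = (\<Sum>v\<in>V. \<Sum>u\<in>U. (cmod (cinner (S v) u))\<^sup>2)"
    if S: "bounded_clinear S" for S
  proof -
    have "Re (op_trace (abs_op S \<circ> abs_op S)) = Re (hs_inner S S)"
      by (simp add: abs_op_square[OF U S] hs_inner_def)
    then have "sqrt (Re (op_trace (abs_op S \<circ> abs_op S))) = hs_norm S"
      by (simp add: hs_norm_def)
    then show ?thesis unfolding hs_norm_eq[OF S] real_sqrt_eq_iff .
  qed
  show "hilbert_schmidt T" by (simp add: hilbert_schmidt_iff T)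
  \<comment> \<open>Arbitrary coefficients \<open>a\<close> cover both \<open>T\<close> itself and
    its transform.\<close>
  have one: "(\<Sum>v'\<in>V. \<Sum>u'\<in>U. (a u' v' * cmod (cinner (T v') u'))\<^sup>2) = (a u v)\<^sup>2" for a :: "'a \<Rightarrow> 'a \<Rightarrow> real"
  proof -
    have "(\<Sum>v'\<in>V. \<Sum>u'\<in>U. (a u' v' * cmod (cinner (T v') u'))\<^sup>2)
        = (\<Sum>v'\<in>V. \<Sum>u'\<in>U. if u' = u then if v' = v then (a u v)\<^sup>2 else 0 else 0)"
      by (intro sum.cong refl) (simp add: coef)
    then show ?thesis using u v finite_basis_finite[OF U] finite_basis_finite[OF V] by simp
  qed
  show "Re (op_trace (abs_op T \<circ> abs_op T)) = 1"
    using one[of "\<lambda>_ _. 1"] by (simp add: HS[OF T])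
  have sq: "sqrt_op (diag_op U q) = diag_op U (\<lambda>u. sqrt (q u))"
    using q by (rule sqrt_op_diag_op[OF U])
  have sp: "sqrt_op (inv (diag_op V p)) = diag_op V (\<lambda>v. sqrt (inverse (p v)))"
    unfolding inv_diag_op using p_pos by (intro sqrt_op_diag_op[OF V]) (simp add: less_imp_le)
  show "Re (op_trace (abs_op (sqrt_op (diag_op U q) \<circ> T \<circ> sqrt_op (inv (diag_op V p))) \<circ>
                       abs_op (sqrt_op (diag_op U q) \<circ> T \<circ> sqrt_op (inv (diag_op V p))))) = ratio u v"
  proof -
    have "(\<Sum>v'\<in>V. \<Sum>u'\<in>U. (cmod (cinner (multiplier (\<lambda>u v. of_real (sqrt (q u) * sqrt (inverse (p v)))) T v') u'))\<^sup>2)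
        = (\<Sum>v'\<in>V. \<Sum>u'\<in>U. (\<bar>sqrt (q u') * sqrt (inverse (p v'))\<bar> * cmod (cinner (T v') u'))\<^sup>2)"
      by (intro sum.cong refl) (simp add: multiplier_coef norm_mult abs_mult del: of_real_mult)
    also have "\<dots> = (sqrt (q u) * sqrt (inverse (p v)))\<^sup>2" unfolding one by simp
    also have "\<dots> = ratio u v"
      using q[OF u] p_pos[OF v] by (simp add: ratio_def power_mult_distrib divide_inverse)
    finally show ?thesis
      unfolding sq sp two_sided_multiplier[OF T] HS[OF multiplier_clinear] .
  qed
qed

end

section \<open>Convex functions of a random variable of mean one\<close>

text \<open>\<open>Lim\<close> has a known value only once convergence is shown. Slopes towards
  \<open>b\<close> increase, so in the extended reals they converge to their supremum, finite or
  not.\<close>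

lemma convex_left_deriv_ge:
  fixes f :: "real \<Rightarrow> real"
  assumes f: "convex_on {0..} f" and y: "0 \<le> y" "y < b"
  shows "ereal ((f y - f b) / (y - b)) \<le> left_deriv f b"
proof -
  let ?s = "\<lambda>y. ereal ((f y - f b) / (y - b))"
  have mono: "?s x \<le> ?s t" if "0 \<le> x" "x \<le> t" "t < b" for x t
    using convex_on_slope_le(2)[OF f, of x b t] that by (cases "x = t") auto
  have "(?s \<longlongrightarrow> (SUP t\<in>{0..<b}. ?s t)) (at_left b)"
  proof (rule order_tendstoI)
    fix l assume "l < (SUP t\<in>{0..<b}. ?s t)"
    then obtain t where t: "0 \<le> t" "t < b" "l < ?s t" by (auto simp: less_SUP_iff)
    have "\<forall>\<^sub>F x in at_left b. x \<in> {t<..<b}" by (rule eventually_at_left_real[OF t(2)])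
    then show "\<forall>\<^sub>F x in at_left b. l < ?s x"
    proof eventually_elim
      case (elim x)
      then show ?case using t mono[of t x] by (simp del: ereal_less_eq add: less_le_trans)
    qed
  next
    fix u assume u: "(SUP t\<in>{0..<b}. ?s t) < u"
    have "\<forall>\<^sub>F x in at_left b. x \<in> {0<..<b}" using y by (intro eventually_at_left_real) auto
    then show "\<forall>\<^sub>F x in at_left b. ?s x < u"
    proof eventually_elim
      case (elim x)
      then have "?s x \<le> (SUP t\<in>{0..<b}. ?s t)" by (intro SUP_upper) auto
      then show ?case using u by (rule le_less_trans)
    qed
  qed
  then have "left_deriv f b = (SUP t\<in>{0..<b}. ?s t)"
    unfolding left_deriv_def by (intro tendsto_Lim) simp_all
  then show ?thesis using y by (auto intro!: SUP_upper)
qed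

text \<open>The mirror image: slopes from \<open>a\<close> decrease as the other point approaches
  \<open>a\<close>, so they converge to their infimum, which may be \<open>-\<infinity>\<close> at
  \<open>a = 0\<close>.\<close>

lemma convex_right_deriv_le:
  fixes f :: "real \<Rightarrow> real"
  assumes f: "convex_on {0..} f" and y: "0 \<le> a" "a < y"
  shows "right_deriv f a \<le> ereal ((f y - f a) / (y - a))"
proof -
  let ?s = "\<lambda>y. ereal ((f y - f a) / (y - a))"
  have flip: "(f x - f a) / (x - a) = (f a - f x) / (a - x)" for x
    by (metis minus_diff_eq minus_divide_divide)
  have mono: "?s x \<le> ?s t" if "a < x" "x \<le> t" for x t
    unfolding flip using convex_on_slope_le(1)[OF f, of a t x] that y(1) by (cases "x = t") auto
  have "(?s \<longlongrightarrow> (INF t\<in>{a<..}. ?s t)) (at_right a)"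
  proof (rule order_tendstoI)
    fix u assume "(INF t\<in>{a<..}. ?s t) < u"
    then obtain t where t: "a < t" "?s t < u" by (auto simp: INF_less_iff)
    have "\<forall>\<^sub>F x in at_right a. x \<in> {a<..<t}" by (rule eventually_at_right_real[OF t(1)])
    then show "\<forall>\<^sub>F x in at_right a. ?s x < u"
    proof eventually_elim
      case (elim x)
      then have "?s x \<le> ?s t" by (intro mono) auto
      then show ?case using t(2) by (rule le_less_trans)
    qed
  next
    fix l assume l: "l < (INF t\<in>{a<..}. ?s t)"
    have "\<forall>\<^sub>F x in at_right a. x \<in> {a<..<y}" by (rule eventually_at_right_real[OF y(2)])
    then show "\<forall>\<^sub>F x in at_right a. l < ?s x"
    proof eventually_elim
      case (elim x)
      then have "(INF t\<in>{a<..}. ?s t) \<le> ?s x" by (intro INF_lower) auto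
      then show ?case by (rule less_le_trans[OF l])
    qed
  qed
  then have "right_deriv f a = (INF t\<in>{a<..}. ?s t)"
    unfolding right_deriv_def by (intro tendsto_Lim) simp_all
  then show ?thesis using y by (auto intro!: INF_lower)
qed

text \<open>The same chord anchored at either end: with \<open>f 1 = 0\<close>, the point 1 is the
  left end for arguments above 1 and the right end for those below.\<close>

lemma convex_below_chord_through:
  fixes f :: "real \<Rightarrow> real"
  assumes f: "convex_on {0..} f" and "0 \<le> a" "a < b" "a \<le> x" "x \<le> b"
  shows "f x \<le> f a + (f b - f a) / (b - a) * (x - a)"
    and "f x \<le> f b + (f b - f a) / (b - a) * (x - b)"
proof -
  have "convex_on {a..b} f" using f assms by (auto intro: convex_on_subset)
  then have le: "f x \<le> (f b - f a) / (b - a) * (x - a) + f a"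
    using assms by (intro convex_onD_Icc') auto
  then show "f x \<le> f a + (f b - f a) / (b - a) * (x - a)" by simp
  have "(f b - f a) / (b - a) * (x - a) = (f b - f a) / (b - a) * (x - b) + (f b - f a)"
    using assms by (simp add: field_simps)
  then show "f x \<le> f b + (f b - f a) / (b - a) * (x - b)" using le by simp
qed

text \<open>Here \<open>t\<close> stands for the trace norm distance, of which only \<open>t \<le> C\<close> matters: if \<open>r = 1\<close> or
  \<open>R = 1\<close>, when \<open>D\<close> can be negative, this forces \<open>t = 0\<close>.\<close>

lemma classical_divergence_bounds:
  fixes f :: "real \<Rightarrow> real" and w x :: "'i \<Rightarrow> real"
  assumes f: "convex_on {0..} f" "f 1 = 0"
    and I: "finite I" and w: "\<And>i. i \<in> I \<Longrightarrow> 0 \<le> w i" "(\<Sum>i\<in>I. w i) = 1"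
    and mean: "(\<Sum>i\<in>I. w i * x i) = 1"
    and x: "\<And>i. i \<in> I \<Longrightarrow> r \<le> x i" "\<And>i. i \<in> I \<Longrightarrow> x i \<le> R"
    and r: "0 \<le> r" "r \<le> 1" "1 \<le> R"
  defines "F \<equiv> \<Sum>i\<in>I. w i * f (x i)" and "V \<equiv> \<Sum>i\<in>I. w i * \<bar>x i - 1\<bar>"
    and "C \<equiv> sqrt (\<Sum>i\<in>I. w i * (x i - 1)\<^sup>2)"
    and "D \<equiv> left_deriv f R - right_deriv f r"
  assumes t: "0 \<le> t" "t \<le> C"
  shows "0 \<le> F" "ereal F \<le> ereal (1/2) * D * ereal V"
    "ereal (1/2) * D * ereal V \<le> ereal (1/2) * D * ereal C"
    "ereal (1/2) * D * ereal C \<le> ereal (1/4) * ereal (R - r) * D"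
    "ereal (1/2) * D * ereal t \<le> ereal (1/2) * D * ereal C"
proof -
  have ne: "I \<noteq> {}" using w(2) by auto
  \<comment> \<open>Jensen's inequality at the mean 1, where \<open>f\<close> vanishes.\<close>
  show F0: "0 \<le> F"
    using convex_on_sum[OF I ne f(1) w(2) w(1), of x] x(1) r(1) mean f(2)
    by (force simp: F_def intro: order_trans)
  have V0: "0 \<le> V" unfolding V_def using w by (intro sum_nonneg mult_nonneg_nonneg) auto
  \<comment> \<open>The variance of \<open>\<bar>x i - 1\<bar>\<close> is nonnegative.\<close>
  have V_le: "V \<le> C"
  proof -
    have "0 \<le> (\<Sum>i\<in>I. w i * (\<bar>x i - 1\<bar> - V)\<^sup>2)" using w by (intro sum_nonneg mult_nonneg_nonneg) auto
    also have "\<dots> = (\<Sum>i\<in>I. w i * (x i - 1)\<^sup>2 - 2 * V * (w i * \<bar>x i - 1\<bar>) + V\<^sup>2 * w i)"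
      by (intro sum.cong refl) (simp add: power2_diff algebra_simps)
    also have "\<dots> = (\<Sum>i\<in>I. w i * (x i - 1)\<^sup>2) - V\<^sup>2"
      by (simp add: sum.distrib sum_subtractf w(2) V_def[symmetric] power2_eq_square flip: sum_distrib_left)
    finally show ?thesis unfolding C_def by (intro real_le_rsqrt) simp
  qed
  \<comment> \<open>The Bhatia-Davis bound for the variance: average
    \<open>(R - x i) * (x i - r) \<ge> 0\<close> and use that the mean is 1.\<close>
  have chi_sq: "(\<Sum>i\<in>I. w i * (x i - 1)\<^sup>2) \<le> (R - 1) * (1 - r)"
  proof -
    have "0 \<le> (\<Sum>i\<in>I. w i * ((R - x i) * (x i - r)))"
      using w x by (intro sum_nonneg mult_nonneg_nonneg) auto
    also have "\<dots> = (\<Sum>i\<in>I. (R + r - 2) * (w i * x i) - (R * r - 1) * w i - w i * (x i - 1)\<^sup>2)"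
      by (intro sum.cong refl) (simp add: power2_eq_square algebra_simps)
    also have "\<dots> = (R + r - 2) - (R * r - 1) - (\<Sum>i\<in>I. w i * (x i - 1)\<^sup>2)"
      by (simp add: sum_subtractf w(2) mean flip: sum_distrib_left)
    finally show ?thesis by (simp add: algebra_simps)
  qed
  \<comment> \<open>The arithmetic-geometric mean inequality for \<open>R - 1\<close> and
    \<open>1 - r\<close>; the resulting half is what turns 1/2 into 1/4 in the last bound.\<close>
  have chi_le: "C \<le> (R - r) / 2"
  proof -
    have "(R - 1) * (1 - r) \<le> ((R - r) / 2)\<^sup>2"
      using zero_le_power2[of "R + r - 2"] by (simp add: power2_eq_square field_simps)
    then show ?thesis unfolding C_def using chi_sq r by (intro real_le_lsqrt) auto
  qed
  \<comment> \<open>Finite slopes bound the extended real \<open>D\<close> from below: the common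
    choice 1 for \<open>y\<close> and \<open>z\<close> gives the chords through the mean, and
    \<open>r\<close>, \<open>R\<close> give the sign of \<open>D\<close>.\<close>
  have D_ge: "ereal ((f y - f R) / (y - R) - (f z - f r) / (z - r)) \<le> D" if "0 \<le> y" "y < R" "r < z" for y z
    using ereal_minus_mono[OF convex_left_deriv_ge[OF f(1) that(1,2)] convex_right_deriv_le[OF f(1) r(1) that(3)]]
    by (simp add: D_def)
  have D0: "0 \<le> D" if "r < R"
  proof -
    have "(f r - f R) / (r - R) = (f R - f r) / (R - r)" by (metis minus_diff_eq minus_divide_divide)
    then show ?thesis using D_ge[of r R] r that by (simp add: zero_ereal_def)
  qed
  have "(ereal F \<le> ereal (1/2) * D * ereal V) \<and> (ereal (1/2) * D * ereal V \<le> ereal (1/2) * D * ereal C)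
    \<and> (ereal (1/2) * D * ereal C \<le> ereal (1/4) * ereal (R - r) * D)
    \<and> (ereal (1/2) * D * ereal t \<le> ereal (1/2) * D * ereal C)"
  proof (cases "r < 1 \<and> 1 < R")
    case True
    define s1 where "s1 = (f R - f 1) / (R - 1)"
    define s0 where "s0 = (f 1 - f r) / (1 - r)"
    \<comment> \<open>The chords from \<open>r\<close> to 1 and from 1 to \<open>R\<close> combine
      into a multiple of \<open>\<bar>x i - 1\<bar>\<close> plus a multiple of
      \<open>x i - 1\<close>. The latter has mean 0, and half the difference of the slopes is the
      source of the factor 1/2.\<close>
    have "f (x i) \<le> (s1 - s0) / 2 * \<bar>x i - 1\<bar> + (s1 + s0) / 2 * (x i - 1)" if i: "i \<in> I" for i
    proof (cases "x i \<le> 1")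
      case le: True
      have "f (x i) \<le> s0 * (x i - 1)"
        using convex_below_chord_through(2)[OF f(1) r(1), of 1 "x i"] True le x(1)[OF i] f(2) by (simp add: s0_def)
      then show ?thesis using le by (simp add: field_simps)
    next
      case False
      have "f (x i) \<le> s1 * (x i - 1)"
        using convex_below_chord_through(1)[OF f(1), of 1 R "x i"] True False x(2)[OF i] f(2) by (simp add: s1_def)
      then show ?thesis using False by (simp add: field_simps)
    qed
    then have "F \<le> (\<Sum>i\<in>I. w i * ((s1 - s0) / 2 * \<bar>x i - 1\<bar> + (s1 + s0) / 2 * (x i - 1)))"
      unfolding F_def using w(1) by (intro sum_mono mult_left_mono)
    also have "\<dots> = (\<Sum>i\<in>I. (s1 - s0) / 2 * (w i * \<bar>x i - 1\<bar>) + (s1 + s0) / 2 * (w i * x i - w i))"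
      by (intro sum.cong refl) (simp add: field_simps)
    also have "\<dots> = (s1 - s0) / 2 * V"
      by (simp only: sum.distrib sum_subtractf w(2) mean V_def sum_distrib_left[symmetric]) simp
    finally have FV: "F \<le> (s1 - s0) / 2 * V" .
    have D_slope: "ereal (s1 - s0) \<le> D"
    proof -
      have "(f 1 - f R) / (1 - R) = s1" unfolding s1_def by (metis minus_diff_eq minus_divide_divide)
      then show ?thesis using D_ge[of 1 1] True by (simp add: s0_def)
    qed
    have pos: "0 \<le> ereal (1/2) * D" using D0 True by (intro ereal_0_le_mult) auto
    have "ereal F \<le> ereal (1/2) * ereal (s1 - s0) * ereal V" using FV by simp
    also have "\<dots> \<le> ereal (1/2) * D * ereal V"
      using D_slope V0 by (intro ereal_mult_right_mono ereal_mult_left_mono) auto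
    finally have 1: "ereal F \<le> ereal (1/2) * D * ereal V" .
    have "ereal (1/2) * D * ereal C \<le> ereal (1/2) * D * ereal ((R - r) / 2)"
      using pos chi_le by (intro ereal_mult_left_mono) auto
    also have "\<dots> = (ereal (1/2) * ereal ((R - r) / 2)) * D" by (simp only: mult_ac)
    also have "ereal (1/2) * ereal ((R - r) / 2) = ereal (1/4) * ereal (R - r)" by simp
    finally show ?thesis using 1 pos V_le t by (auto intro!: ereal_mult_left_mono)
  next
    case False
    \<comment> \<open>The mean sits at an end of the interval, so the variance vanishes and
      \<open>x i = 1\<close> wherever the weight is positive.\<close>
    then have "(R - 1) * (1 - r) = 0" using r by auto
    then have "C \<le> 0" unfolding C_def using chi_sq by (intro real_le_lsqrt) auto
    then have zero: "C = 0" "V = 0" "t = 0" using V_le V0 t by auto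
    have "F = 0" unfolding F_def
    proof (rule sum.neutral, rule ballI)
      fix i assume i: "i \<in> I"
      have "w i * \<bar>x i - 1\<bar> = 0"
        using zero(2) i I w(1) by (subst (asm) V_def, subst (asm) sum_nonneg_eq_0_iff) auto
      then show "w i * f (x i) = 0" using f(2) by auto
    qed
    \<comment> \<open>For \<open>r = R\<close> the sign of \<open>D\<close> is not under control,
      but its coefficient is 0.\<close>
    moreover have "0 \<le> ereal (1/4) * ereal (R - r) * D"
    proof (cases "r = R")
      case False
      then show ?thesis using D0 r by (intro ereal_0_le_mult) auto
    qed (simp flip: zero_ereal_def)
    ultimately show ?thesis using zero by (simp flip: zero_ereal_def)
  qed
  then show "ereal F \<le> ereal (1/2) * D * ereal V"
    "ereal (1/2) * D * ereal V \<le> ereal (1/2) * D * ereal C"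
    "ereal (1/2) * D * ereal C \<le> ereal (1/4) * ereal (R - r) * D"
    "ereal (1/2) * D * ereal t \<le> ereal (1/2) * D * ereal C" by blast+
qed

theorem theorem8:
  fixes f :: "real \<Rightarrow> real"
    and Q P :: "'a::complex_hilbert_space \<Rightarrow> 'a"
    and r R :: real
  assumes "continuous_on {0..} f" and "convex_on {0..} f" and "f 1 = 0"
    and "density_op Q" and "density_op P" and "invertible_op P"
    and "0 \<le> r" and "r \<le> 1" and "1 \<le> R"
    and "\<And>T. hilbert_schmidt T \<Longrightarrow>
           r * Re (op_trace (abs_op T \<circ> abs_op T))
             \<le> Re (op_trace (abs_op (sqrt_op Q \<circ> T \<circ> sqrt_op (inv P)) \<circ>
                             abs_op (sqrt_op Q \<circ> T \<circ> sqrt_op (inv P))))"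
    and "\<And>T. hilbert_schmidt T \<Longrightarrow>
           Re (op_trace (abs_op (sqrt_op Q \<circ> T \<circ> sqrt_op (inv P)) \<circ>
                         abs_op (sqrt_op Q \<circ> T \<circ> sqrt_op (inv P))))
             \<le> R * Re (op_trace (abs_op T \<circ> abs_op T))"
  shows "let D = left_deriv f R - right_deriv f r in
           0 \<le> divergence f Q P \<and>
           ereal (divergence f Q P) \<le> ereal (1/2) * D * ereal (variational_distance Q P) \<and>
           ereal (1/2) * D * ereal (variational_distance Q P)
             \<le> ereal (1/2) * D * ereal (chi_distance Q P) \<and>
           ereal (1/2) * D * ereal (chi_distance Q P) \<le> ereal (1/4) * ereal (R - r) * D \<and>
           ereal (1/2) * D * ereal (trace_norm_distance Q P)
             \<le> ereal (1/2) * D * ereal (chi_distance Q P)"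
proof -
  obtain E :: "'a set" where E: "finite_basis E"
    by (rule invertible_density_op_finite_basis[OF assms(5,6)])
  obtain U q where U: "finite_basis U" and Q: "Q = diag_op U q" and q: "\<And>u. u \<in> U \<Longrightarrow> 0 \<le> q u"
    using positive_op_eigenbasis[OF E, of Q] assms(4) by (auto simp: density_op_def)
  obtain V p where V: "finite_basis V" and P: "P = diag_op V p" and p: "\<And>v. v \<in> V \<Longrightarrow> 0 \<le> p v"
    using positive_op_eigenbasis[OF E, of P] assms(5) by (auto simp: density_op_def)
  \<comment> \<open>The ratios divide by \<open>p v\<close>; a zero eigenvalue would put a unit
    vector into the kernel of the invertible \<open>P\<close>.\<close>
  have "p v \<noteq> 0" if v: "v \<in> V" for v
  proof
    assume "p v = 0"
    then have "P v = 0" by (simp add: P diag_op_basis[OF V v])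
    obtain S where S: "bounded_clinear S" "S \<circ> P = id" using assms(6) by (auto simp: invertible_op_def)
    have "v = S (P v)" using S(2) by (simp add: fun_eq_iff)
    also have "\<dots> = 0" using \<open>P v = 0\<close> bounded_clinear_zero[OF S(1)] by simp
    finally show False using finite_basis_norm[OF V v] by simp
  qed
  then interpret two_bases U V q p
    using U V p by unfold_locales (auto simp: less_le)
  have "complex_of_real (\<Sum>v\<in>V. p v) = of_real 1" "complex_of_real (\<Sum>u\<in>U. q u) = of_real 1"
    using assms(4,5) by (simp_all only: density_op_def P Q op_trace_diag_op[OF U] op_trace_diag_op[OF V] of_real_1)
  then have p1: "(\<Sum>v\<in>V. p v) = 1" and q1: "(\<Sum>u\<in>U. q u) = 1"
    unfolding of_real_eq_iff by blast+
  have bounds: "r \<le> ratio u v" "ratio u v \<le> R" if uv: "u \<in> U" "v \<in> V" for u v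
  proof -
    obtain T where "hilbert_schmidt T" "Re (op_trace (abs_op T \<circ> abs_op T)) = 1"
      "Re (op_trace (abs_op (sqrt_op Q \<circ> T \<circ> sqrt_op (inv P)) \<circ>
                     abs_op (sqrt_op Q \<circ> T \<circ> sqrt_op (inv P)))) = ratio u v"
      unfolding P Q by (rule rank_one_ratio[OF q uv])
    then show "r \<le> ratio u v" "ratio u v \<le> R" using assms(10,11)[of T] by auto
  qed
  let ?I = "V \<times> U" and ?w = "\<lambda>(v, u). weight u v" and ?x = "\<lambda>(v, u). ratio u v"
  have flatten: "(\<Sum>v\<in>V. \<Sum>u\<in>U. weight u v * g (ratio u v)) = (\<Sum>i\<in>?I. ?w i * g (?x i))" for g
    by (simp add: sum.cartesian_product case_prod_beta)
  have w1: "(\<Sum>i\<in>?I. ?w i) = 1" using sum_weight p1 by (simp add: sum.cartesian_product)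
  have mean: "(\<Sum>i\<in>?I. ?w i * ?x i) = 1"
    using sum_weight_ratio q1 flatten[of "\<lambda>t. t"] by simp
  \<comment> \<open>Mean and total mass are both 1, so the second moment minus 1 is the centred
    second moment.\<close>
  have chi: "chi_distance Q P = sqrt (\<Sum>i\<in>?I. ?w i * (?x i - 1)\<^sup>2)"
  proof -
    have "(\<Sum>i\<in>?I. ?w i * (?x i - 1)\<^sup>2) = (\<Sum>i\<in>?I. ?w i * (?x i)\<^sup>2 - 2 * (?w i * ?x i) + ?w i)"
      by (intro sum.cong refl) (simp add: power2_diff algebra_simps)
    also have "\<dots> = (\<Sum>i\<in>?I. ?w i * (?x i)\<^sup>2) - 1"
      by (simp only: sum.distrib sum_subtractf mean w1 sum_distrib_left[symmetric])
    finally show ?thesis unfolding P Q chi_distance_eq flatten[of "\<lambda>t. t\<^sup>2"] by simp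
  qed
  have div: "divergence g Q P = (\<Sum>i\<in>?I. ?w i * g (?x i))" for g
    unfolding P Q divergence_eq flatten ..
  have t: "trace_norm_distance Q P \<le> sqrt (\<Sum>i\<in>?I. ?w i * (?x i - 1)\<^sup>2)" "0 \<le> trace_norm_distance Q P"
    using trace_norm_distance_le[OF p1] unfolding P Q flatten[of "\<lambda>t. (t - 1)\<^sup>2"] by auto
  have fin: "finite ?I" using finite_basis_finite[OF U] finite_basis_finite[OF V] by simp
  have w0: "\<And>i. i \<in> ?I \<Longrightarrow> 0 \<le> ?w i" using p by (auto simp: weight_def)
  have xr: "\<And>i. i \<in> ?I \<Longrightarrow> r \<le> ?x i" and xR: "\<And>i. i \<in> ?I \<Longrightarrow> ?x i \<le> R" using bounds by auto
  show ?thesis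
    unfolding Let_def variational_distance_def chi div
    by (intro conjI classical_divergence_bounds[OF assms(2,3) fin w0 w1 mean xr xR assms(7-9) t(2,1)])
qed

end
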